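(* Let $d\ge 1$ and let $V:\mathbb{R}^d\to\mathbb{R}$ be continuous, bounded and nonnegative. Let $u:\mathbb{R}^d\to\mathbb{C}$ be a nontrivial (i.e. not identically zero) solution of $\Delta u=Vu$ on $\mathbb{R}^d$. Then there exists a constant $c>0$, independent of $R$, such that for every $R\in\mathbb{N}$ $$\int_{R\le |x|\le R+1}|u(x)|^2\,dx\ge c .$$
   Context: $\Delta=\sum_{i=1}^d\partial_{x_i}^2$ is the Laplacian on $\mathbb{R}^d$ and $|x|$ is the Euclidean norm. Solutions are understood to be of class $C^2(\mathbb{R}^d)$, with the equation holding pointwise. The constant $c$ may depend on $u$, $V$ and $d$. *)

theory Defs
  imports "HOL-Analysis.Analysis"
begin

definition has_partial :: "'n::finite \<Rightarrow> (real ^ 'n \<Rightarrow> 'b::real_normed_vector) \<Rightarrow> real ^ 'n \<Rightarrow> bool" where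
  "has_partial i f x \<longleftrightarrow> (\<lambda>t::real. f (x + t *\<^sub>R axis i 1)) differentiable (at 0)"

text \<open>Only meaningful at points where \<^term>\<open>has_partial i f x\<close> holds.\<close>

definition partial_deriv :: "'n::finite \<Rightarrow> (real ^ 'n \<Rightarrow> 'b::real_normed_vector) \<Rightarrow> real ^ 'n \<Rightarrow> 'b" where
  "partial_deriv i f x = vector_derivative (\<lambda>t::real. f (x + t *\<^sub>R axis i 1)) (at 0)"

text \<open>All partial derivatives exist everywhere and are continuous; continuity of the function
  itself is a consequence, as usual.\<close>

definition C1_on_space :: "(real ^ 'n::finite \<Rightarrow> 'b::real_normed_vector) \<Rightarrow> bool" where
  "C1_on_space f \<longleftrightarrow>
     (\<forall>i. (\<forall>x. has_partial i f x) \<and> continuous_on UNIV (partial_deriv i f))"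

definition C2_on_space :: "(real ^ 'n::finite \<Rightarrow> 'b::real_normed_vector) \<Rightarrow> bool" where
  "C2_on_space f \<longleftrightarrow> C1_on_space f \<and> (\<forall>i. C1_on_space (partial_deriv i f))"

definition laplacian :: "(real ^ 'n::finite \<Rightarrow> 'b::real_normed_vector) \<Rightarrow> real ^ 'n \<Rightarrow> 'b" where
  "laplacian f x = (\<Sum>i\<in>UNIV. partial_deriv i (partial_deriv i f) x)"

end

theory Submission
  imports Defs
begin

text \<open>The function \<open>w = |u|\<^sup>2\<close> is subharmonic because \<open>V \<ge> 0\<close>. By the maximum principle its maximum over the
  ball of radius \<open>R + 1/2\<close> is attained at some \<open>x\<close> with \<open>|x| = R + 1/2\<close>, and by the mean value inequality
  \<open>w x\<close> is at most a constant times the integral of \<open>w\<close> over the ball of radius \<open>1/2\<close> around \<open>x\<close>, which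
  lies in the shell. So the shell integral is bounded below by a multiple of the maximum of \<open>w\<close> over
  the ball of radius \<open>1/2\<close> around the origin. That maximum is positive by unique continuation, which
  follows from a Carleman estimate with weight \<open>exp (\<tau> (L - ln |x|)\<^sup>2)\<close>, convex in the variable \<open>ln |x|\<close>.\<close>

section \<open>Partial derivatives\<close>

text \<open>Neither surface measure nor polar coordinates occur: spherical means are replaced by
  integrals against a compactly supported weight, and every integration by parts reduces to the
  vanishing integral of a partial derivative of a compactly supported function. The obstacle is
  unique continuation: \<open>V\<close> is merely continuous and bounded, so solutions need not be
  analytic. It is enough to exclude vanishing on a full ball around the origin, so the Carleman
  estimate is applied to functions that vanish near the singularity of \<open>ln |x|\<close>.
  Convexity of the phase yields a zero-order gain of order \<open>\<tau> ^ 3\<close>, which absorbs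
  the bounded potential for large \<open>\<tau>\<close>. As \<open>V\<close> is real, the real and
  imaginary parts of \<open>u\<close> solve the same equation, so real-valued analysis suffices. The
  radius 1/2 is half the width of the shell; for \<open>R = 0\<close> it is also the radius of the
  ball in which \<open>u\<close> must be nonzero somewhere, and that ball lies inside all the larger
  ones, which makes the constant independent of \<open>R\<close>.\<close>

definition has_partial_deriv ::
  "'n::finite \<Rightarrow> (real ^ 'n \<Rightarrow> real) \<Rightarrow> real ^ 'n \<Rightarrow> real \<Rightarrow> bool" where
  "has_partial_deriv i f x D \<longleftrightarrow>
     ((\<lambda>t. f (x + t *\<^sub>R axis i 1)) has_real_derivative D) (at 0)"

lemma has_partial_deriv_cong:
  "has_partial_deriv i f x D \<Longrightarrow> D = D' \<Longrightarrow> has_partial_deriv i f x D'"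
  by simp

lemma has_partial_deriv_const: "has_partial_deriv i (\<lambda>x. c) x 0"
  by (simp add: has_partial_deriv_def)

lemma has_partial_deriv_add:
  "has_partial_deriv i f x D \<Longrightarrow> has_partial_deriv i g x D' \<Longrightarrow>
     has_partial_deriv i (\<lambda>x. f x + g x) x (D + D')"
  unfolding has_partial_deriv_def by (rule DERIV_add)

lemma has_partial_deriv_diff:
  "has_partial_deriv i f x D \<Longrightarrow> has_partial_deriv i g x D' \<Longrightarrow>
     has_partial_deriv i (\<lambda>x. f x - g x) x (D - D')"
  unfolding has_partial_deriv_def by (rule DERIV_diff)

lemma has_partial_deriv_mult:
  "has_partial_deriv i f x D \<Longrightarrow> has_partial_deriv i g x D' \<Longrightarrow>
     has_partial_deriv i (\<lambda>x. f x * g x) x (D * g x + f x * D')"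
  unfolding has_partial_deriv_def by (drule (1) DERIV_mult) (simp add: mult.commute)

lemma has_partial_deriv_sum:
  "(\<And>j. j \<in> S \<Longrightarrow> has_partial_deriv i (f j) x (D j)) \<Longrightarrow>
     has_partial_deriv i (\<lambda>x. \<Sum>j\<in>S. f j x) x (\<Sum>j\<in>S. D j)"
  unfolding has_partial_deriv_def by (rule DERIV_sum)

lemma has_partial_deriv_chain:
  assumes "(g has_real_derivative G) (at (f x))" "has_partial_deriv i f x D"
  shows "has_partial_deriv i (\<lambda>x. g (f x)) x (G * D)"
proof -
  have "(g has_real_derivative G) (at (f (x + 0 *\<^sub>R axis i 1)))"
    using assms(1) by simp
  then show ?thesis
    using assms(2) unfolding has_partial_deriv_def by (rule DERIV_chain2)
qed

lemma has_partial_deriv_nth: "has_partial_deriv i (\<lambda>x. x $ j) x (axis i 1 $ j)"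
  unfolding has_partial_deriv_def by (auto intro!: derivative_eq_intros)

lemma has_partial_deriv_inner_self: "has_partial_deriv i (\<lambda>x. x \<bullet> x) x (2 * x $ i)"
  unfolding has_partial_deriv_def
  by (auto intro!: derivative_eq_intros simp: inner_axis inner_axis' inner_simps)

text \<open>Bridge to one-variable calculus: it turns partial derivatives along a coordinate line
  into derivatives at every parameter of the restriction to that line, as the mean value theorems
  require.\<close>

lemma has_partial_deriv_translate:
  "has_partial_deriv i f (x + s *\<^sub>R axis i 1) D \<longleftrightarrow>
     ((\<lambda>t. f (x + t *\<^sub>R axis i 1)) has_real_derivative D) (at s)"
  using DERIV_shift[of "\<lambda>t. f (x + t *\<^sub>R axis i 1)" D 0 s]
  by (simp add: has_partial_deriv_def add.assoc scaleR_left_distrib[symmetric] add.commute[of s])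

lemma has_partial_deriv_local:
  assumes "has_partial_deriv i f x D" "open S" "x \<in> S" "\<And>y. y \<in> S \<Longrightarrow> f y = g y"
  shows "has_partial_deriv i g x D"
proof -
  have "open ((\<lambda>t::real. x + t *\<^sub>R axis i 1) -` S)"
    by (intro continuous_open_vimage assms(2) continuous_intros)
  then have "eventually (\<lambda>t. f (x + t *\<^sub>R axis i 1) = g (x + t *\<^sub>R axis i 1)) (nhds (0::real))"
    using assms by (auto simp: eventually_nhds)
  with assms(1) show ?thesis
    unfolding has_partial_deriv_def by (subst (asm) DERIV_cong_ev) auto
qed

lemma has_partial_deriv_unique:
  "has_partial_deriv i f x D \<Longrightarrow> has_partial_deriv i f x D' \<Longrightarrow> D = D'"
  unfolding has_partial_deriv_def by (rule DERIV_unique)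

text \<open>The coordinates of the increment are switched on one at a time, each change being
  controlled by a one-variable mean value inequality. The induction runs over the set
  \<open>S\<close> of coordinates that may be nonzero.\<close>

lemma sum_partials_increment:
  fixes f :: "real ^ 'n::finite \<Rightarrow> real"
  assumes pd: "\<And>i x. has_partial_deriv i f x (g i x)"
    and S: "finite S"
    and bd: "\<And>i y. norm (y - x) < d \<Longrightarrow> \<bar>g i y - g i x\<bar> \<le> e"
    and h: "\<And>i. i \<notin> S \<Longrightarrow> h $ i = 0" "norm h < d"
  shows "\<bar>f (x + h) - f x - (\<Sum>i\<in>S. h $ i * g i x)\<bar> \<le> e * (\<Sum>i\<in>S. \<bar>h $ i\<bar>)"
  using S h
proof (induction S arbitrary: h rule: finite_induct)
  case empty
  then have "h = 0" by (simp add: vec_eq_iff)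
  then show ?case by simp
next
  case (insert k S)
  define h' where "h' = h - (h $ k) *\<^sub>R axis k 1"
  have hh: "h = h' + (h $ k) *\<^sub>R axis k 1" by (simp add: h'_def)
  have h'n: "h' $ i = (if i = k then 0 else h $ i)" for i
    by (auto simp: h'_def axis_def)
  \<comment> \<open>No coordinate of an intermediate point exceeds that of \<open>h\<close> in
    absolute value, so the path stays where \<open>bd\<close> applies.\<close>
  have norm_le: "norm (h' + s *\<^sub>R axis k 1) < d" if "\<bar>s\<bar> \<le> \<bar>h $ k\<bar>" for s
  proof -
    have "norm (h' + s *\<^sub>R axis k 1) \<le> norm h"
      by (rule norm_le_componentwise_cart) (use that in \<open>auto simp: h'n axis_def\<close>)
    with insert.prems show ?thesis by simp
  qed
  have IH: "\<bar>f (x + h') - f x - (\<Sum>i\<in>S. h' $ i * g i x)\<bar> \<le> e * (\<Sum>i\<in>S. \<bar>h' $ i\<bar>)"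
    using insert.prems norm_le[of 0] by (intro insert.IH) (auto simp: h'n)
  have S': "(\<Sum>i\<in>S. h' $ i * g i x) = (\<Sum>i\<in>S. h $ i * g i x)"
       "(\<Sum>i\<in>S. \<bar>h' $ i\<bar>) = (\<Sum>i\<in>S. \<bar>h $ i\<bar>)"
    using insert.hyps by (auto intro!: sum.cong simp: h'n)
  \<comment> \<open>With the linear part at \<open>x\<close> subtracted, the derivative is exactly
    the difference that \<open>bd\<close> estimates.\<close>
  have der: "((\<lambda>t. f (x + h' + t *\<^sub>R axis k 1) - t * g k x)
     has_real_derivative (g k (x + h' + t *\<^sub>R axis k 1) - g k x)) (at t)" for t
    using pd[of k "x + h' + t *\<^sub>R axis k 1", unfolded has_partial_deriv_translate]
    by (auto intro!: derivative_eq_intros)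
  have "norm ((f (x + h' + (h $ k) *\<^sub>R axis k 1) - h $ k * g k x)
      - (f (x + h' + 0 *\<^sub>R axis k 1) - 0 * g k x)) \<le> e * norm (h $ k - 0)"
  proof (rule field_differentiable_bound[where S = "{-\<bar>h $ k\<bar>..\<bar>h $ k\<bar>}"])
    fix t assume t: "t \<in> {-\<bar>h $ k\<bar>..\<bar>h $ k\<bar>}"
    show "((\<lambda>t. f (x + h' + t *\<^sub>R axis k 1) - t * g k x)
     has_real_derivative (g k (x + h' + t *\<^sub>R axis k 1) - g k x)) (at t within {-\<bar>h $ k\<bar>..\<bar>h $ k\<bar>})"
      by (rule has_field_derivative_at_within[OF der])
    show "norm (g k (x + h' + t *\<^sub>R axis k 1) - g k x) \<le> e"
      using bd[of "x + h' + t *\<^sub>R axis k 1"] norm_le[of t] t by (auto simp: add.assoc)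
  qed auto
  then have "\<bar>f (x + h) - f (x + h') - h $ k * g k x\<bar> \<le> e * \<bar>h $ k\<bar>"
    by (subst hh) (simp add: add.assoc algebra_simps)
  with IH S' show ?case
    using insert.hyps by (simp add: algebra_simps)
qed

lemma C1_imp_has_derivative:
  fixes f :: "real ^ 'n::finite \<Rightarrow> real"
  assumes pd: "\<And>i x. has_partial_deriv i f x (g i x)"
    and cont: "\<And>i. continuous_on UNIV (g i)"
  shows "(f has_derivative (\<lambda>h. \<Sum>i\<in>UNIV. h $ i * g i x)) (at x)"
  unfolding has_derivative_at_alt
proof (intro conjI allI impI)
  show "bounded_linear (\<lambda>h. \<Sum>i\<in>UNIV. h $ i * g i x)"
    by (intro bounded_linear_sum bounded_linear_mult_const bounded_linear_vec_nth)
  fix e :: real assume e: "0 < e"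
  \<comment> \<open>The sum of the \<open>\<bar>h $ i\<bar>\<close> is at most
    \<open>c * norm h\<close>, so accuracy \<open>e / c\<close> in each partial derivative gives
    \<open>e\<close>.\<close>
  define c where "c = real CARD('n)"
  have c: "c > 0" by (simp add: c_def)
  have "\<exists>d>0. \<forall>y. dist y x < d \<longrightarrow> dist (g i y) (g i x) < e / c" for i
  proof -
    have "isCont (g i) x" using cont by (simp add: continuous_on_eq_continuous_at)
    then show ?thesis
      using e c unfolding continuous_at_eps_delta by (simp add: dist_norm)
  qed
  then obtain d where d: "\<And>i. d i > 0"
      "\<And>i y. dist y x < d i \<Longrightarrow> dist (g i y) (g i x) < e / c"
    by metis
  define d0 where "d0 = Min (range d)"
  have d0: "d0 > 0" "d0 \<le> d i" for i
    using d by (auto simp: d0_def)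
  show "\<exists>d>0. \<forall>y. norm (y - x) < d \<longrightarrow>
      norm (f y - f x - (\<Sum>i\<in>UNIV. (y - x) $ i * g i x)) \<le> e * norm (y - x)"
  proof (intro exI[of _ d0] conjI d0 allI impI)
    fix y assume y: "norm (y - x) < d0"
    have "\<bar>f (x + (y - x)) - f x - (\<Sum>i\<in>UNIV. (y - x) $ i * g i x)\<bar>
        \<le> e / c * (\<Sum>i\<in>UNIV. \<bar>(y - x) $ i\<bar>)"
    proof (rule sum_partials_increment[where d = d0])
      fix i and z :: "real ^ 'n" assume "norm (z - x) < d0"
      then have "dist z x < d i" using d0(2)[of i] by (simp add: dist_norm)
      then show "\<bar>g i z - g i x\<bar> \<le> e / c"
        using d(2)[of z i] by (simp add: dist_real_def)
    qed (use pd y in auto)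
    also have "\<dots> \<le> e / c * (\<Sum>i::'n\<in>UNIV. norm (y - x))"
      using e c by (intro mult_left_mono sum_mono component_le_norm_cart) auto
    also have "\<dots> = e * norm (y - x)"
      using c by (simp add: c_def)
    finally show "norm (f y - f x - (\<Sum>i\<in>UNIV. (y - x) $ i * g i x)) \<le> e * norm (y - x)"
      by simp
  qed
qed

lemma C1_imp_continuous:
  fixes f :: "real ^ 'n::finite \<Rightarrow> real"
  assumes "\<And>i x. has_partial_deriv i f x (g i x)" "\<And>i. continuous_on UNIV (g i)"
  shows "continuous_on UNIV f"
  using has_derivative_continuous[OF C1_imp_has_derivative[OF assms]]
  by (simp add: continuous_on_eq_continuous_at)

lemma C1_has_derivative_along_ray:
  fixes f :: "real ^ 'n::finite \<Rightarrow> real"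
  assumes "\<And>i x. has_partial_deriv i f x (g i x)" "\<And>i. continuous_on UNIV (g i)"
  shows "((\<lambda>r. f (x + r *\<^sub>R y)) has_real_derivative (\<Sum>i\<in>UNIV. y $ i * g i (x + r *\<^sub>R y))) (at r)"
proof -
  have "((\<lambda>r. f (x + r *\<^sub>R y)) has_derivative
       (\<lambda>s. \<Sum>i\<in>UNIV. (s *\<^sub>R y) $ i * g i (x + r *\<^sub>R y))) (at r)"
    by (rule has_derivative_compose[where f = "\<lambda>r. x + r *\<^sub>R y" and g = f])
      (auto intro!: derivative_eq_intros C1_imp_has_derivative assms)
  then show ?thesis
    unfolding has_field_derivative_def
    by (rule has_derivative_eq_rhs) (auto simp: fun_eq_iff sum_distrib_left mult_ac)
qed

section \<open>Integrals of compactly supported functions and of their partial derivatives\<close>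

lemma integrable_continuous_compact_support:
  fixes f :: "'a::euclidean_space \<Rightarrow> real"
  assumes "continuous_on UNIV f" "\<And>x. norm x \<ge> \<rho> \<Longrightarrow> f x = 0"
  shows "integrable lborel f"
proof -
  have "integrable lborel (\<lambda>x. indicator (cball 0 \<rho>) x *\<^sub>R f x)"
    by (rule borel_integrable_compact) (auto intro: continuous_on_subset assms)
  also have "(\<lambda>x. indicator (cball 0 \<rho>) x *\<^sub>R f x) = f"
    using assms(2) by (auto simp: indicator_def fun_eq_iff not_le intro!: assms(2)[symmetric])
  finally show ?thesis .
qed

lemma integral_lborel_translate:
  fixes f :: "'a::euclidean_space \<Rightarrow> real"
  assumes "f \<in> borel_measurable borel"
  shows "(LINT x|lborel. f (a + x)) = (LINT x|lborel. f x)"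
  by (subst (2) lborel_distr_plus[of a, symmetric]) (use assms in \<open>simp add: integral_distr\<close>)

text \<open>By translation invariance of the Lebesgue measure the difference quotients of \<open>f\<close> already have
  integral zero.\<close>

lemma integral_partial_deriv_eq_0:
  fixes f :: "real ^ 'n::finite \<Rightarrow> real"
  assumes pd: "\<And>x. has_partial_deriv i f x (f' x)"
    and cf: "continuous_on UNIV f" and cont: "continuous_on UNIV f'"
    and supp: "\<And>x. norm x \<ge> \<rho> \<Longrightarrow> f x = 0"
  shows "(LINT x|lborel. f' x) = 0"
proof -
  \<comment> \<open>Shifts have length at most 1: beyond \<open>\<bar>\<rho>\<bar> + 1\<close> the
    difference quotients vanish, and from within that radius a shifted point stays in
    \<open>cball 0 r\<close>. The absolute value covers negative \<open>\<rho>\<close>.\<close>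
  define r where "r = \<bar>\<rho>\<bar> + 2"
  define t where "t n = 1 / real (Suc n)" for n
  have t: "0 < t n" "t n \<le> 1" for n by (auto simp: t_def)
  have t_lim: "t \<longlonglongrightarrow> 0"
    unfolding t_def using LIMSEQ_inverse_real_of_nat by (simp add: inverse_eq_divide)
  have "bounded (f' ` cball 0 r)"
    by (intro compact_imp_bounded compact_continuous_image continuous_on_subset[OF cont]) auto
  then obtain B where B: "\<And>x. norm x \<le> r \<Longrightarrow> \<bar>f' x\<bar> \<le> B"
    by (force simp: bounded_iff)
  define Q where "Q n x = (f (t n *\<^sub>R axis i 1 + x) - f x) / t n" for n x
  have intf: "integrable lborel f"
    by (rule integrable_continuous_compact_support[OF cf supp])
  have f_borel: "f \<in> borel_measurable borel" "f' \<in> borel_measurable borel"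
    using cf cont by (auto intro: borel_measurable_continuous_onI)
  have intQ: "(LINT x|lborel. Q n x) = 0" for n
  proof -
    have "integrable lborel (\<lambda>x. f (t n *\<^sub>R axis i 1 + x))"
      using intf f_borel lborel_distr_plus[of "t n *\<^sub>R axis i 1 :: real ^ 'n"]
        integrable_distr_eq[of "(+) (t n *\<^sub>R axis i 1)" lborel borel f] by simp
    then show ?thesis
      using intf unfolding Q_def by (simp add: integral_lborel_translate[OF f_borel(1)])
  qed
  have "(\<lambda>n. LINT x|lborel. Q n x) \<longlonglongrightarrow> (LINT x|lborel. f' x)"
  proof (rule integral_dominated_convergence)
    show "f' \<in> borel_measurable lborel" using f_borel by simp
    show "Q n \<in> borel_measurable lborel" for n
      unfolding Q_def using f_borel by measurable
    show "integrable lborel (\<lambda>x::real ^ 'n. indicator (cball 0 r) x *\<^sub>R B)"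
      by (rule borel_integrable_compact) auto
    show "AE x in lborel. (\<lambda>n. Q n x) \<longlonglongrightarrow> f' x"
    proof (rule AE_I2)
      fix x
      have "((\<lambda>h. (f (x + (0 + h) *\<^sub>R axis i 1) - f (x + 0 *\<^sub>R axis i 1)) / h) \<longlongrightarrow> f' x) (at 0)"
        using pd[of x] unfolding has_partial_deriv_def DERIV_def .
      moreover have "filterlim t (at 0) sequentially"
        using t_lim t unfolding filterlim_at by (auto simp: less_imp_neq[THEN not_sym])
      ultimately have "((\<lambda>n. (f (x + (0 + t n) *\<^sub>R axis i 1) - f (x + 0 *\<^sub>R axis i 1)) / t n) \<longlongrightarrow> f' x) sequentially"
        by (rule filterlim_compose)
      then show "(\<lambda>n. Q n x) \<longlonglongrightarrow> f' x"
        by (simp add: Q_def add.commute)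
    qed
    show "AE x in lborel. norm (Q n x) \<le> indicator (cball 0 r) x *\<^sub>R B" for n
    proof (rule AE_I2)
      fix x :: "real ^ 'n"
      show "norm (Q n x) \<le> indicator (cball 0 r) x *\<^sub>R B"
      proof (cases "norm x \<le> \<bar>\<rho>\<bar> + 1")
        case False
        have "norm x \<le> norm (t n *\<^sub>R axis i 1 + x) + norm (t n *\<^sub>R (axis i 1 :: real ^ 'n))"
          by (metis add_diff_cancel_left' norm_triangle_ineq4 add.commute)
        then have "norm (t n *\<^sub>R axis i 1 + x) \<ge> \<rho>"
          using False t[of n] by simp
        then have "Q n x = 0" using False supp by (simp add: Q_def)
        moreover have "0 \<le> B" using B[of 0] by (simp add: r_def)
        ultimately show ?thesis by (simp add: indicator_def)
      next
        case True
        have "norm (f (x + t n *\<^sub>R axis i 1) - f (x + 0 *\<^sub>R axis i 1)) \<le> B * norm (t n - 0)"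
        proof (rule field_differentiable_bound[where S = "{0..t n}" and f' = "\<lambda>s. f' (x + s *\<^sub>R axis i 1)"])
          fix s assume s: "s \<in> {0..t n}"
          show "((\<lambda>t. f (x + t *\<^sub>R axis i 1)) has_real_derivative f' (x + s *\<^sub>R axis i 1)) (at s within {0..t n})"
            using pd[of "x + s *\<^sub>R axis i 1", unfolded has_partial_deriv_translate]
            by (rule has_field_derivative_at_within)
          have "norm (x + s *\<^sub>R axis i 1) \<le> norm x + norm (s *\<^sub>R (axis i 1 :: real ^ 'n))"
            by (rule norm_triangle_ineq)
          then show "norm (f' (x + s *\<^sub>R axis i 1)) \<le> B"
            using True s t[of n] by (intro order_trans[OF _ B]) (auto simp: r_def)
        qed (use t[of n] in auto)
        then have "norm (Q n x) \<le> B"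
          using t[of n] by (simp add: Q_def add.commute field_simps)
        then show ?thesis using True by (simp add: r_def)
      qed
    qed
  qed
  then show ?thesis using intQ by (simp add: LIMSEQ_const_iff)
qed

section \<open>Mixed partial derivatives and the maximum principle\<close>

text \<open>The second difference over a square is a first difference in direction \<open>i\<close>
  of a first difference in direction \<open>j\<close>, so the mean value theorem applies
  twice.\<close>

lemma mixed_difference_mean_value:
  fixes f :: "real ^ 'n::finite \<Rightarrow> real"
  assumes f: "\<And>x. has_partial_deriv i f x (g x)" and g: "\<And>x. has_partial_deriv j g x (h x)"
    and s: "s > 0"
  obtains \<xi> \<eta> where "0 < \<xi>" "\<xi> < s" "0 < \<eta>" "\<eta> < s"
    "f (x + s *\<^sub>R axis i 1 + s *\<^sub>R axis j 1) - f (x + s *\<^sub>R axis i 1) - f (x + s *\<^sub>R axis j 1) + f x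
      = s\<^sup>2 * h (x + \<xi> *\<^sub>R axis i 1 + \<eta> *\<^sub>R axis j 1)"
proof -
  define \<phi> where "\<phi> t = f ((x + s *\<^sub>R axis j 1) + t *\<^sub>R axis i 1) - f (x + t *\<^sub>R axis i 1)" for t
  have "(\<phi> has_real_derivative
      (g ((x + s *\<^sub>R axis j 1) + t *\<^sub>R axis i 1) - g (x + t *\<^sub>R axis i 1))) (at t)" for t
    unfolding \<phi>_def using f by (intro DERIV_diff) (simp_all flip: has_partial_deriv_translate)
  from MVT2[OF s this] obtain \<xi> where \<xi>: "0 < \<xi>" "\<xi> < s" and
    1: "\<phi> s - \<phi> 0 = s * (g ((x + s *\<^sub>R axis j 1) + \<xi> *\<^sub>R axis i 1) - g (x + \<xi> *\<^sub>R axis i 1))"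
    by auto
  have "((\<lambda>t. g ((x + \<xi> *\<^sub>R axis i 1) + t *\<^sub>R axis j 1)) has_real_derivative
      (h ((x + \<xi> *\<^sub>R axis i 1) + t *\<^sub>R axis j 1))) (at t)" for t
    using g by (simp flip: has_partial_deriv_translate)
  from MVT2[OF s this] obtain \<eta> where \<eta>: "0 < \<eta>" "\<eta> < s" and
    2: "g ((x + \<xi> *\<^sub>R axis i 1) + s *\<^sub>R axis j 1) - g (x + \<xi> *\<^sub>R axis i 1)
        = s * h ((x + \<xi> *\<^sub>R axis i 1) + \<eta> *\<^sub>R axis j 1)"
    by auto
  show ?thesis
    using that[OF \<xi> \<eta>] 1 2 by (simp add: \<phi>_def add_ac power2_eq_square algebra_simps)
qed

text \<open>The second difference over a square is symmetric in the two directions. Hence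
  \<open>h i j\<close> and \<open>h j i\<close> take a common value, at possibly different points
  arbitrarily close to \<open>x\<close>, and continuity finishes.\<close>

lemma mixed_partials_commute:
  fixes f :: "real ^ 'n::finite \<Rightarrow> real"
  assumes f: "\<And>i x. has_partial_deriv i f x (g i x)"
    and g: "\<And>i j x. has_partial_deriv j (g i) x (h i j x)"
    and cont: "\<And>i j. continuous_on UNIV (h i j)"
  shows "h i j x = h j i x"
proof -
  have "\<bar>h i j x - h j i x\<bar> \<le> e" if e: "e > 0" for e
  proof -
    have "\<exists>d>0. \<forall>y. dist y x < d \<longrightarrow> dist (h i j y) (h i j x) < e / 2" for i j
    proof -
      have "isCont (h i j) x" using cont by (simp add: continuous_on_eq_continuous_at)
      then show ?thesis
        using half_gt_zero[OF e] unfolding continuous_at_eps_delta by blast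
    qed
    then obtain d1 d2 where d: "d1 > 0" "d2 > 0"
       "\<And>y. dist y x < d1 \<Longrightarrow> dist (h i j y) (h i j x) < e / 2"
       "\<And>y. dist y x < d2 \<Longrightarrow> dist (h j i y) (h j i x) < e / 2"
      by metis
    \<comment> \<open>Both intermediate points are two steps of length below \<open>s\<close> away
      from \<open>x\<close>.\<close>
    define s where "s = min d1 d2 / 2"
    have s: "s > 0" "2 * s \<le> d1" "2 * s \<le> d2" using d by (auto simp: s_def)
    obtain a b where ab: "0 < a" "a < s" "0 < b" "b < s"
      "f (x + s *\<^sub>R axis i 1 + s *\<^sub>R axis j 1) - f (x + s *\<^sub>R axis i 1) - f (x + s *\<^sub>R axis j 1) + f x
      = s\<^sup>2 * h i j (x + a *\<^sub>R axis i 1 + b *\<^sub>R axis j 1)"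
      using mixed_difference_mean_value[OF f g s(1)] by metis
    obtain a' b' where ab': "0 < a'" "a' < s" "0 < b'" "b' < s"
      "f (x + s *\<^sub>R axis j 1 + s *\<^sub>R axis i 1) - f (x + s *\<^sub>R axis j 1) - f (x + s *\<^sub>R axis i 1) + f x
      = s\<^sup>2 * h j i (x + a' *\<^sub>R axis j 1 + b' *\<^sub>R axis i 1)"
      using mixed_difference_mean_value[OF f g s(1)] by metis
    have eq: "h i j (x + a *\<^sub>R axis i 1 + b *\<^sub>R axis j 1) = h j i (x + a' *\<^sub>R axis j 1 + b' *\<^sub>R axis i 1)"
    proof -
      have "f (x + s *\<^sub>R axis j 1 + s *\<^sub>R axis i 1) = f (x + s *\<^sub>R axis i 1 + s *\<^sub>R axis j 1)"
        by (simp add: add_ac)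
      then have "s\<^sup>2 * h i j (x + a *\<^sub>R axis i 1 + b *\<^sub>R axis j 1)
          = s\<^sup>2 * h j i (x + a' *\<^sub>R axis j 1 + b' *\<^sub>R axis i 1)"
        using ab(5) ab'(5) by argo
      then show ?thesis using s(1) by simp
    qed
    have "dist (x + c *\<^sub>R axis k 1 + c' *\<^sub>R axis l 1) x < 2 * s" if "0 < c" "c < s" "0 < c'" "c' < s"
      for c c' and k l :: 'n
      using norm_triangle_ineq[of "c *\<^sub>R (axis k 1 :: real ^ 'n)" "c' *\<^sub>R axis l 1"] that
      by (simp add: dist_norm add.assoc)
    with ab ab' s have "dist (x + a *\<^sub>R axis i 1 + b *\<^sub>R axis j 1) x < d1"
      "dist (x + a' *\<^sub>R axis j 1 + b' *\<^sub>R axis i 1) x < d2"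
      by (meson less_le_trans)+
    from d(3)[OF this(1)] d(4)[OF this(2)] eq show ?thesis
      unfolding dist_real_def by linarith
  qed
  then show ?thesis
    by (metis abs_ge_zero dense_ge eq_iff_diff_eq_0 abs_eq_0 antisym)
qed

text \<open>Gradient and Hessian are carried as explicit functions, so that product and chain rules
  yield formulas that can be computed with. The index order is that \<open>h i j\<close>
  differentiates \<open>g i\<close> in direction \<open>j\<close>.\<close>

definition C2_jet ::
  "(real ^ 'n::finite \<Rightarrow> real) \<Rightarrow> ('n \<Rightarrow> real ^ 'n \<Rightarrow> real) \<Rightarrow> ('n \<Rightarrow> 'n \<Rightarrow> real ^ 'n \<Rightarrow> real) \<Rightarrow> bool" where
  "C2_jet f g h \<longleftrightarrow>
     (\<forall>i x. has_partial_deriv i f x (g i x)) \<and>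
     (\<forall>i j x. has_partial_deriv j (g i) x (h i j x)) \<and>
     (\<forall>i j. continuous_on UNIV (h i j))"

lemma C2_jetD:
  assumes "C2_jet f g h"
  shows "has_partial_deriv i f x (g i x)" "has_partial_deriv j (g i) x (h i j x)"
    "continuous_on UNIV f" "continuous_on UNIV (g i)" "continuous_on UNIV (h i j)"
    "h i j x = h j i x"
proof -
  from assms show f: "has_partial_deriv i f x (g i x)" and g: "has_partial_deriv j (g i) x (h i j x)"
      and h: "continuous_on UNIV (h i j)" for i j x
    by (auto simp: C2_jet_def)
  show gc: "continuous_on UNIV (g i)" for i
    using g h by (rule C1_imp_continuous)
  show "continuous_on UNIV f"
    using f gc by (rule C1_imp_continuous)
  show "h i j x = h j i x"
    using f g h by (rule mixed_partials_commute)
qed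

lemma C2_jet_add:
  assumes "C2_jet f g h" "C2_jet f' g' h'"
  shows "C2_jet (\<lambda>x. f x + f' x) (\<lambda>i x. g i x + g' i x) (\<lambda>i j x. h i j x + h' i j x)"
  using C2_jetD(1-5)[OF assms(1)] C2_jetD(1-5)[OF assms(2)] unfolding C2_jet_def
  by (auto intro!: has_partial_deriv_add continuous_intros)

lemma C2_jet_mult:
  assumes "C2_jet f g h" "C2_jet f' g' h'"
  shows "C2_jet (\<lambda>x. f x * f' x) (\<lambda>i x. g i x * f' x + f x * g' i x)
    (\<lambda>i j x. (h i j x * f' x + g i x * g' j x) + (g j x * g' i x + f x * h' i j x))"
  using C2_jetD(1-5)[OF assms(1)] C2_jetD(1-5)[OF assms(2)] unfolding C2_jet_def
  by (auto intro!: has_partial_deriv_add has_partial_deriv_mult continuous_intros)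

text \<open>At the maximum the first derivative vanishes; were \<open>D\<close> positive, it would
  be positive just to the right, and the function would rise above its maximum.\<close>

lemma second_partial_nonpos_at_local_max:
  fixes f :: "real ^ 'n::finite \<Rightarrow> real"
  assumes f: "\<And>x. has_partial_deriv i f x (g x)" and g: "has_partial_deriv i g z D"
    and d: "d > 0" and max: "\<And>y. dist z y < d \<Longrightarrow> f y \<le> f z"
  shows "D \<le> 0"
proof (rule ccontr)
  assume "\<not> D \<le> 0"
  then have D: "D > 0" by simp
  define \<phi> where "\<phi> t = f (z + t *\<^sub>R axis i 1)" for t
  define \<gamma> where "\<gamma> t = g (z + t *\<^sub>R axis i 1)" for t
  have \<phi>: "(\<phi> has_real_derivative \<gamma> t) (at t)" for t
    using f unfolding \<phi>_def \<gamma>_def by (simp flip: has_partial_deriv_translate)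
  have \<phi>max: "\<phi> t \<le> \<phi> 0" if "\<bar>t\<bar> < d" for t
    using max[of "z + t *\<^sub>R axis i 1"] that by (simp add: \<phi>_def dist_norm)
  have \<gamma>0: "\<gamma> 0 = 0"
    by (rule DERIV_local_max[OF \<phi> d]) (use \<phi>max in auto)
  have "(\<gamma> has_real_derivative D) (at 0)"
    using g by (simp add: has_partial_deriv_def \<gamma>_def[abs_def])
  from DERIV_pos_inc_right[OF this D] obtain e where e: "e > 0"
    "\<And>t. 0 < t \<Longrightarrow> t < e \<Longrightarrow> \<gamma> t > 0"
    using \<gamma>0 by auto
  define t where "t = min d e / 2"
  have t: "0 < t" "t < d" "t < e" using d e by (auto simp: t_def)
  obtain s where s: "0 < s" "s < t" "\<phi> t - \<phi> 0 = (t - 0) * \<gamma> s"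
    using MVT2[OF t(1) \<phi>] by auto
  with t e(2)[of s] have "\<phi> t > \<phi> 0"
    by (simp add: algebra_simps)
  with \<phi>max[of t] t show False by simp
qed

text \<open>Adding \<open>e * (y \<bullet> y)\<close> makes the Laplacian strictly positive, which
  rules out an interior maximum, where all pure second derivatives are nonpositive.\<close>

lemma weak_maximum_principle:
  fixes w :: "real ^ 'n::finite \<Rightarrow> real"
  assumes w: "C2_jet w g h" and sub: "\<And>x. (\<Sum>i\<in>UNIV. h i i x) \<ge> 0" and r: "r \<ge> 0"
  obtains x where "norm x = r" "\<And>y. norm y \<le> r \<Longrightarrow> w y \<le> w x"
proof -
  note w = C2_jetD[OF w]
  have "norm (r *\<^sub>R axis undefined 1 :: real ^ 'n) = r" using r by simp
  then have ne: "sphere 0 r \<noteq> ({} :: (real ^ 'n) set)" using mem_sphere_0 by blast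
  obtain x where x: "x \<in> sphere 0 r" "\<And>y. y \<in> sphere 0 r \<Longrightarrow> w y \<le> w x"
    using continuous_attains_sup[of "sphere 0 r" w, OF compact_sphere ne]
      continuous_on_subset[OF w(3)] by blast
  have "w y0 \<le> w x" if y0: "norm y0 \<le> r" for y0
  proof (rule ccontr)
    assume "\<not> w y0 \<le> w x"
    \<comment> \<open>Small enough that the perturbation, at most \<open>e * r\<^sup>2\<close> on
      the ball, cannot lift a boundary value to \<open>w y0\<close>; the added 1 allows
      \<open>r = 0\<close>.\<close>
    define e where "e = (w y0 - w x) / (r\<^sup>2 + 1)"
    have e: "e > 0" "e * r\<^sup>2 < w y0 - w x"
    proof -
      have "r\<^sup>2 + 1 > 0" by (simp add: add_nonneg_pos)
      with \<open>\<not> w y0 \<le> w x\<close> show "e > 0" "e * r\<^sup>2 < w y0 - w x"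
        by (auto simp: e_def field_simps)
    qed
    define W where "W y = w y + e * (y \<bullet> y)" for y
    have W: "has_partial_deriv i W y (g i y + e * (2 * y $ i))" for i y
      using has_partial_deriv_add[OF w(1) has_partial_deriv_mult[OF has_partial_deriv_const has_partial_deriv_inner_self]]
      by (simp add: W_def[abs_def])
    have G: "has_partial_deriv i (\<lambda>y. g i y + e * (2 * y $ i)) y (h i i y + e * 2)" for i y
      by (rule has_partial_deriv_cong[OF has_partial_deriv_add[OF w(2) has_partial_deriv_mult[OF
         has_partial_deriv_const has_partial_deriv_mult[OF has_partial_deriv_const has_partial_deriv_nth]]]])
        simp
    have "continuous_on (cball 0 r) W"
      unfolding W_def by (intro continuous_intros continuous_on_subset[OF w(3)]) auto
    then obtain z where z: "z \<in> cball 0 r" "\<And>y. y \<in> cball 0 r \<Longrightarrow> W y \<le> W z"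
      using continuous_attains_sup[of "cball 0 r" W] r by auto
    have "norm z < r"
    proof (rule ccontr)
      assume "\<not> norm z < r"
      with z(1) have zr: "norm z = r" by simp
      have "w y0 \<le> W y0" using e by (simp add: W_def)
      also have "\<dots> \<le> W z" using y0 by (intro z) simp
      also have "\<dots> = w z + e * r\<^sup>2" using zr by (simp add: W_def dot_square_norm)
      also have "\<dots> \<le> w x + e * r\<^sup>2" using x zr by simp
      finally show False using e by simp
    qed
    then have "h i i z + e * 2 \<le> 0" for i
    proof (intro second_partial_nonpos_at_local_max[OF W G, where d = "r - norm z"])
      fix y assume "norm z < r" "dist z y < r - norm z"
      then have "norm y \<le> r" using norm_triangle_ineq2[of y z] by (simp add: dist_norm norm_minus_commute)
      then show "W y \<le> W z" by (intro z) simp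
    qed simp
    then have "(\<Sum>i\<in>UNIV. h i i z + e * 2) \<le> 0" by (intro sum_nonpos) simp
    then have "(\<Sum>i\<in>UNIV. h i i z) + real CARD('n) * (e * 2) \<le> 0"
      by (simp add: sum.distrib)
    moreover have "real CARD('n) * (e * 2) > 0" using e by simp
    ultimately show False using sub[of z] by linarith
  qed
  with x(1) that show ?thesis by auto
qed

section \<open>The mean value inequality\<close>

text \<open>Only the corner at 0 needs care: there the difference quotient is
  \<open>max 0 h ^ (n - 1)\<close>, which tends to 0 as \<open>n \<ge> 2\<close>. All bumps and
  cutoffs below are built from such powers.\<close>

lemma DERIV_pos_part_power:
  fixes t :: real
  assumes "n \<ge> 2"
  shows "((\<lambda>t. max 0 t ^ n) has_real_derivative real n * max 0 t ^ (n - 1)) (at t)"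
proof -
  consider "t > 0" | "t < 0" | "t = 0" by linarith
  then show ?thesis
  proof cases
    case 1
    have "((\<lambda>t. t ^ n) has_real_derivative real n * t ^ (n - 1)) (at t)"
      by (auto intro!: derivative_eq_intros)
    then have "((\<lambda>t. max 0 t ^ n) has_real_derivative real n * t ^ (n - 1)) (at t)"
      by (rule has_field_derivative_transform_within_open[where S = "{0<..}"])
        (use 1 in \<open>auto simp: max_def\<close>)
    with 1 show ?thesis by (simp add: max_def)
  next
    case 2
    have "((\<lambda>t. 0) has_real_derivative 0) (at t)" by simp
    then have "((\<lambda>t. max 0 t ^ n) has_real_derivative 0) (at t)"
      by (rule has_field_derivative_transform_within_open[where S = "{..<0}"])
        (use 2 assms in \<open>auto simp: max_def\<close>)
    moreover have "real n * max 0 t ^ (n - 1) = 0" using 2 assms by (simp add: max_def)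
    ultimately show ?thesis by (simp only:)
  next
    case 3
    have "((\<lambda>h. max 0 h ^ (n - 1)) \<longlongrightarrow> max 0 0 ^ (n - 1)) (at (0::real))"
      by (intro tendsto_intros)
    moreover have "max 0 0 ^ (n - 1) = (0::real)"
      using assms by (simp add: power_0_left)
    ultimately have lim: "((\<lambda>h. max 0 h ^ (n - 1)) \<longlongrightarrow> 0) (at (0::real))"
      by (simp only:)
    have "(max 0 (0 + h) ^ n - max 0 0 ^ n) / h = max 0 h ^ (n - 1)" if "h \<noteq> 0" for h :: real
    proof (cases "h > 0")
      case True
      then show ?thesis using assms
        by (cases n) (auto simp: max_def)
    next
      case False
      with assms that show ?thesis by (auto simp: max_def)
    qed
    then have "((\<lambda>h. (max 0 (0 + h) ^ n - max 0 0 ^ n) / h) \<longlongrightarrow> 0) (at (0::real))"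
      by (intro Lim_transform_eventually[OF lim]) (auto simp: eventually_at_filter)
    moreover have "real n * max 0 t ^ (n - 1) = 0"
      using 3 assms by (simp add: power_0_left)
    ultimately show ?thesis using 3 by (simp only: DERIV_def)
  qed
qed

lemma has_partial_deriv_affine:
  assumes "has_partial_deriv i f (x + r *\<^sub>R y) D"
  shows "has_partial_deriv i (\<lambda>y. f (x + r *\<^sub>R y)) y (r * D)"
proof -
  have "((\<lambda>t. f ((x + r *\<^sub>R y) + t *\<^sub>R axis i 1)) has_real_derivative D) (at (r * 0))"
    using assms by (simp add: has_partial_deriv_def)
  from DERIV_chain2[where g = "\<lambda>t. r * t" and x = 0, OF this DERIV_cmult_Id] show ?thesis
    by (simp add: has_partial_deriv_def algebra_simps)
qed

text \<open>Links two integrals: on a box, differentiation under the integral sign and the zero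
  criterion are applied; on the whole space, translation invariance and the vanishing of integrated
  partial derivatives.\<close>

lemma integral_cbox_eq_lborel:
  fixes f :: "'a::euclidean_space \<Rightarrow> real"
  assumes "continuous_on UNIV f" "\<And>x. norm x \<ge> \<rho> \<Longrightarrow> f x = 0" "cball 0 \<rho> \<subseteq> cbox a b"
  shows "integral (cbox a b) f = (LINT x|lborel. f x)"
proof -
  have *: "(\<lambda>x. indicator (cbox a b) x *\<^sub>R f x) = f"
  proof
    fix x
    show "indicator (cbox a b) x *\<^sub>R f x = f x"
      using assms(2)[of x] assms(3) by (cases "norm x \<le> \<rho>") (auto simp: indicator_def)
  qed
  have "set_integrable lborel (cbox a b) f"
    unfolding set_integrable_def *
    by (rule integrable_continuous_compact_support[OF assms(1,2)])
  from set_borel_integral_eq_integral(2)[OF this] show ?thesis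
    unfolding set_lebesgue_integral_def * by simp
qed

lemma cball_subset_cbox:
  obtains a b :: "'a::euclidean_space" where "cball 0 \<rho> \<subseteq> cbox a b"
  using bounded_subset_cbox_symmetric[OF bounded_cball] by metis

lemma integral_zero_imp_zero:
  fixes f :: "'a::euclidean_space \<Rightarrow> real"
  assumes f: "continuous_on UNIV f" "\<And>x. norm x \<ge> \<rho> \<Longrightarrow> f x = 0" "\<And>x. f x \<ge> 0"
    and "(LINT x|lborel. f x) = 0"
  shows "f x = 0"
proof (cases "norm x \<ge> \<rho>")
  case False
  \<comment> \<open>The maximum with 1 forces the box to have nonempty interior, whatever
    \<open>\<rho>\<close> is.\<close>
  obtain a b :: 'a where ab: "cball 0 (max \<rho> 1) \<subseteq> cbox a b" using cball_subset_cbox .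
  have "ball 0 1 \<subseteq> cbox a b"
    using ab by (auto intro!: subset_trans[OF _ ab])
  then have "ball 0 1 \<subseteq> interior (cbox a b)"
    by (rule interior_maximal) simp
  then have "box a b \<noteq> {}" unfolding interior_cbox
    by (metis centre_in_ball empty_iff subsetD zero_less_one)
  moreover have "integral (cbox a b) f = 0"
    using integral_cbox_eq_lborel[OF f(1,2), where a = a and b = b] ab assms(4) by (auto simp: subset_iff)
  moreover have "x \<in> cbox a b" using False ab by (auto simp: subset_iff)
  ultimately show ?thesis
    using integral_cbox_eq_0_iff[OF continuous_on_subset[OF f(1)], of a b] f(3) by auto
qed (use f in auto)

text \<open>The constant 1/4 is the square of the support radius 1/2. Being a power of the positive
  part of a quadratic, the weight makes \<open>bump y *\<^sub>R y\<close> a gradient with an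
  elementary potential.\<close>

definition bump :: "'a::real_inner \<Rightarrow> real" where
  "bump y = max 0 (1 / 4 - y \<bullet> y) ^ 2"

lemma bump_props:
  "bump y \<ge> 0" "bump y \<le> 1" "norm y \<ge> 1 / 2 \<Longrightarrow> bump y = 0" "continuous_on S bump" "bump 0 > 0"
proof -
  have "max 0 (1 / 4 - y \<bullet> y) \<le> 1"
    using inner_ge_zero[of y] by (simp add: max_def del: inner_ge_zero)
  then show "bump y \<le> 1" unfolding bump_def by (intro power_le_one) auto
  show "bump y = 0" if "norm y \<ge> 1 / 2"
  proof -
    have "(1 / 2)\<^sup>2 \<le> (norm y)\<^sup>2" using that by (intro power_mono) auto
    then show ?thesis by (simp add: bump_def dot_square_norm power2_eq_square)
  qed
  show "continuous_on S bump" unfolding bump_def by (intro continuous_intros)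
qed (auto simp: bump_def)

text \<open>The mean of \<open>w (x\<^sub>0 + r y)\<close> against the weight \<^const>\<open>bump\<close> is nondecreasing in \<open>r\<close>:
  since \<open>bump y *\<^sub>R y\<close> is minus the gradient of \<open>\<Phi> = max 0 (1/4 - y \<bullet> y)^3 / 6\<close>, its derivative equals
  the integral of \<open>r \<Phi> \<Delta>w\<close>.\<close>

lemma weighted_mean_value_inequality:
  fixes w :: "real ^ 'n::finite \<Rightarrow> real"
  assumes w: "C2_jet w g h" and sub: "\<And>x. (\<Sum>i\<in>UNIV. h i i x) \<ge> 0"
  shows "w x * (LINT y|lborel. bump (y :: real ^ 'n)) \<le> (LINT y|lborel. bump y * w (x + y))"
proof -
  note w = C2_jetD[OF w]
  obtain a b :: "real ^ 'n" where ab: "cball 0 (1/2) \<subseteq> cbox a b" using cball_subset_cbox .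
  define \<Phi> where "\<Phi> y = max 0 (1 / 4 - y \<bullet> y) ^ 3 / 6" for y :: "real ^ 'n"
  have \<Phi>_nonneg: "\<Phi> y \<ge> 0" for y by (simp add: \<Phi>_def)
  have \<Phi>_supp: "\<Phi> y = 0" if "norm y \<ge> 1 / 2" for y
  proof -
    have "(1 / 2)\<^sup>2 \<le> (norm y)\<^sup>2" using that by (intro power_mono) auto
    then show ?thesis by (simp add: \<Phi>_def dot_square_norm power2_eq_square)
  qed
  have \<Phi>_cont: "continuous_on UNIV \<Phi>" unfolding \<Phi>_def by (intro continuous_intros) auto
  have \<Phi>_pd: "has_partial_deriv i \<Phi> y (- (y $ i * bump y))" for i y
  proof -
    have "((\<lambda>t. max 0 (1 / 4 - t) ^ 3 / 6) has_real_derivative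
        (- 3 * max 0 (1 / 4 - y \<bullet> y) ^ 2 / 6)) (at (y \<bullet> y))"
      by (rule derivative_eq_intros DERIV_chain2[OF DERIV_pos_part_power[of 3]] | simp)+
    from has_partial_deriv_chain[OF this has_partial_deriv_inner_self] show ?thesis
      by (simp add: \<Phi>_def[abs_def] bump_def mult_ac)
  qed
  have cont_comp: "continuous_on UNIV (\<lambda>y. F (x + r *\<^sub>R y))" if "continuous_on UNIV F"
    for F :: "real ^ 'n \<Rightarrow> real" and r
    by (intro continuous_on_compose2[OF that] continuous_intros) auto
  define m where "m r = integral (cbox a b) (\<lambda>y. bump y * w (x + r *\<^sub>R y))" for r
  define m' where "m' r = integral (cbox a b) (\<lambda>y. bump y * (\<Sum>i\<in>UNIV. y $ i * g i (x + r *\<^sub>R y)))" for r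
  have m_eq: "m r = (LINT y|lborel. bump y * w (x + r *\<^sub>R y))" for r
    unfolding m_def using ab bump_props
    by (intro integral_cbox_eq_lborel[where \<rho> = "1/2"] continuous_intros cont_comp w) auto
  have deriv: "(m has_real_derivative m' r) (at r)" for r
    unfolding m_def m'_def
  proof (rule leibniz_rule_field_derivative[where U = UNIV])
    show "((\<lambda>r. bump y * w (x + r *\<^sub>R y)) has_real_derivative
       bump y * (\<Sum>i\<in>UNIV. y $ i * g i (x + r *\<^sub>R y))) (at r within UNIV)" for r y
      by (intro DERIV_cmult C1_has_derivative_along_ray w)
    show "(\<lambda>y. bump y * w (x + r *\<^sub>R y)) integrable_on cbox a b" for r
      by (intro integrable_continuous continuous_intros bump_props
          continuous_on_subset[OF cont_comp] w) auto
    show "continuous_on (UNIV \<times> cbox a b) (\<lambda>(r, y). bump y * (\<Sum>i\<in>UNIV. y $ i * g i (x + r *\<^sub>R y)))"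
      unfolding case_prod_beta
      by (intro continuous_intros continuous_on_compose2[OF bump_props(4)[of UNIV]]
          continuous_on_compose2[OF w(4)]) auto
  qed auto
  have "m' r \<ge> 0" if "r \<ge> 0" for r
  proof -
    \<comment> \<open>The field is \<open>\<Phi>\<close> times the gradient of \<open>w\<close> at
      \<open>x + r *\<^sub>R y\<close>; its divergence integrates to zero, which is the integration
      by parts.\<close>
    define P where "P i y = \<Phi> y * g i (x + r *\<^sub>R y)" for i y
    define P' where "P' i y = - (y $ i * bump y) * g i (x + r *\<^sub>R y) + \<Phi> y * (r * h i i (x + r *\<^sub>R y))" for i y
    have pd: "has_partial_deriv i (P i) y (P' i y)" for i y
      unfolding P_def P'_def
      by (intro has_partial_deriv_mult \<Phi>_pd has_partial_deriv_affine w)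
    have P'_cont: "continuous_on UNIV (P' i)" for i
      unfolding P'_def by (intro continuous_intros cont_comp w bump_props \<Phi>_cont)
    have int0: "(LINT y|lborel. P' i y) = 0" for i
      by (rule integral_partial_deriv_eq_0[OF pd _ P'_cont, where \<rho> = "1/2"])
        (auto simp: P_def \<Phi>_supp intro!: continuous_intros \<Phi>_cont cont_comp w)
    have intP': "integrable lborel (P' i)" for i
      by (rule integrable_continuous_compact_support[OF P'_cont, where \<rho> = "1/2"])
        (auto simp: P'_def \<Phi>_supp bump_props)
    have int: "integrable lborel (\<lambda>y. \<Phi> y * (r * (\<Sum>i\<in>UNIV. h i i (x + r *\<^sub>R y))))"
      by (rule integrable_continuous_compact_support[where \<rho> = "1/2"])
        (auto simp: \<Phi>_supp intro!: continuous_intros \<Phi>_cont cont_comp w)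
    have "m' r = (LINT y|lborel. bump y * (\<Sum>i\<in>UNIV. y $ i * g i (x + r *\<^sub>R y)))"
      unfolding m'_def using ab bump_props
      by (intro integral_cbox_eq_lborel[where \<rho> = "1/2"] continuous_intros cont_comp w) auto
    also have "(\<lambda>y. bump y * (\<Sum>i\<in>UNIV. y $ i * g i (x + r *\<^sub>R y)))
        = (\<lambda>y. \<Phi> y * (r * (\<Sum>i\<in>UNIV. h i i (x + r *\<^sub>R y))) - (\<Sum>i\<in>UNIV. P' i y))"
      by (simp add: P'_def fun_eq_iff sum.distrib sum_distrib_left sum_negf sum_subtractf mult_ac)
    also have "(LINT y|lborel. \<dots> y) = (LINT y|lborel. \<Phi> y * (r * (\<Sum>i\<in>UNIV. h i i (x + r *\<^sub>R y))))"
      using int intP' int0 by (simp add: Bochner_Integration.integral_sum)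
    also have "\<dots> \<ge> 0"
      by (intro integral_nonneg_AE AE_I2 mult_nonneg_nonneg \<Phi>_nonneg that sub)
    finally show ?thesis .
  qed
  then have "m 0 \<le> m 1"
    by (intro DERIV_nonneg_imp_nondecreasing[of 0 1 m]) (use deriv in auto)
  then show ?thesis by (simp add: m_eq mult.commute)
qed

lemma integral_bump_pos: "(LINT y|lborel. bump (y :: 'a::euclidean_space)) > 0"
proof -
  have "(LINT y|lborel. bump (y :: 'a)) \<ge> 0"
    by (intro integral_nonneg_AE AE_I2 bump_props)
  moreover have "(LINT y|lborel. bump (y :: 'a)) \<noteq> 0"
    using integral_zero_imp_zero[of "bump :: 'a \<Rightarrow> real" "1/2" 0] bump_props
    by (metis less_irrefl)
  ultimately show ?thesis by simp
qed

text \<open>The weight centred at \<open>x\<close> is at most 1 and vanishes outside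
  \<open>cball x (1 / 2)\<close>, so for nonnegative \<open>w\<close> it may be replaced by the
  indicator of \<open>S\<close>.\<close>

lemma subharmonic_le_integral:
  fixes w :: "real ^ 'n::finite \<Rightarrow> real"
  assumes w: "C2_jet w g h" and sub: "\<And>x. (\<Sum>i\<in>UNIV. h i i x) \<ge> 0" and nonneg: "\<And>x. w x \<ge> 0"
    and S: "compact S" "cball x (1 / 2) \<subseteq> S"
  shows "w x * (LINT y|lborel. bump (y :: real ^ 'n)) \<le> (LINT y:S|lborel. w y)"
proof -
  note cont = C2_jetD(3)[OF w]
  have bc: "continuous_on UNIV (\<lambda>y. bump (- x + y) * w y)"
    by (intro continuous_intros cont continuous_on_compose2[OF bump_props(4)[of UNIV]]) auto
  have supp: "bump (- x + y) = 0" if "y \<notin> S" for y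
  proof -
    have "y \<notin> cball x (1/2)" using that S by auto
    then show ?thesis by (intro bump_props) (simp add: dist_norm norm_minus_commute)
  qed
  have "w x * (LINT y|lborel. bump (y :: real ^ 'n)) \<le> (LINT y|lborel. bump y * w (x + y))"
    by (rule weighted_mean_value_inequality[OF w sub])
  also have "\<dots> = (LINT y|lborel. bump (- x + (x + y)) * w (x + y))"
    by simp
  also have "\<dots> = (LINT y|lborel. bump (- x + y) * w y)"
    by (rule integral_lborel_translate[of "\<lambda>y. bump (- x + y) * w y"])
      (intro borel_measurable_continuous_onI bc)
  also have "\<dots> \<le> (LINT y|lborel. indicator S y *\<^sub>R w y)"
  proof (rule integral_mono)
    show S_int: "integrable lborel (\<lambda>y. indicator S y *\<^sub>R w y)"
      by (rule borel_integrable_compact[OF S(1)]) (auto intro: continuous_on_subset cont)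
    show le: "bump (- x + y) * w y \<le> indicator S y *\<^sub>R w y" for y
      using supp[of y] bump_props(2)[of "- x + y"] nonneg[of y]
      by (auto simp: indicator_def intro: mult_left_le_one_le bump_props)
    show "integrable lborel (\<lambda>y. bump (- x + y) * w y)"
    proof (rule Bochner_Integration.integrable_bound[OF S_int])
      show "AE y in lborel. norm (bump (- x + y) * w y) \<le> norm (indicator S y *\<^sub>R w y)"
      proof (rule AE_I2)
        fix y
        have "norm (bump (- x + y) * w y) = bump (- x + y) * w y"
          using nonneg bump_props(1)[of "- x + y"] by (simp add: abs_mult)
        with le[of y] show "norm (bump (- x + y) * w y) \<le> norm (indicator S y *\<^sub>R w y)"
          by simp
      qed
    qed (use bc in \<open>auto intro!: borel_measurable_continuous_onI\<close>)
  qed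
  finally show ?thesis by (simp add: set_lebesgue_integral_def)
qed

section \<open>A Carleman estimate\<close>

lemma C2_jet_eq_0_on_open:
  assumes jet: "C2_jet f g h" and S: "open S" "\<And>x. x \<in> S \<Longrightarrow> f x = 0" and x: "x \<in> S"
  shows "g i x = 0" "h i j x = 0"
proof -
  note jet = C2_jetD[OF jet]
  have g0: "g i y = 0" if "y \<in> S" for y
    using has_partial_deriv_local[OF has_partial_deriv_const[of i 0 y] S(1) that, of f] S(2)
      has_partial_deriv_unique[OF jet(1)] by metis
  show "g i x = 0" by (rule g0[OF x])
  show "h i j x = 0"
    using has_partial_deriv_local[OF has_partial_deriv_const[of j 0 x] S(1) x, of "g i"] g0
      has_partial_deriv_unique[OF jet(2)] by metis
qed

text \<open>The pointwise content of the Carleman estimate: \<open>N\<close>, \<open>E\<close>, \<open>G\<close>, \<open>D\<close> stand for \<open>|x|\<^sup>2\<close>, \<open>x \<bullet> \<nabla>v\<close>, \<open>|\<nabla>v|\<^sup>2\<close>, \<open>\<Delta>v\<close>,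
  \<open>m + 2\<close> is the dimension, \<open>W = exp (\<tau> l\<^sup>2)\<close> and \<open>a = 2 \<tau> l\<close> with \<open>l = L - ln |x|\<close>, and \<open>Y\<close> is the divergence of
  \<open>W a (E \<nabla>v - G x / 2) + W b v \<nabla>v + (W q / N) v\<^sup>2 x\<close>. The identity comes from conjugating
  \<open>|x|\<^sup>2 \<Delta>\<close> by the weight and pairing its symmetric part with its antisymmetric part; as \<open>l\<close> is affine in
  \<open>ln |x|\<close>, no third derivative of the phase appears.\<close>

lemma carleman_algebraic_identity:
  fixes N W a b q \<tau> m E G D v Y :: real
  assumes N: "N > 0" and b: "b = (a * m - a\<^sup>2) / 2 - \<tau>" and q: "q = - (a * b + \<tau> * m) / 2"
    and Y: "Y = - (W * (a\<^sup>2 + 2 * \<tau>)) / N * (E\<^sup>2 - N * G / 2)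
      + W * a * (D * E + G - (m + 2) / 2 * G)
      - W * (a * b + \<tau> * (m - 2 * a)) / N * v * E + W * b * (G + v * D)
      - (W * (a * q - \<tau> * b - a * \<tau> * (m - 2 * a) / 2) + 2 * (W * q)) / N * v\<^sup>2
      + W * q / N * ((m + 2) * v\<^sup>2 + 2 * v * E)"
  shows "N * W * D\<^sup>2 - 2 * \<tau> * a\<^sup>2 * W * v\<^sup>2 / N - 4 * Y =
    W / N * ((N * D - 2 * (a * E + b * v))\<^sup>2 + 8 * \<tau> * (E + (m - a) / 2 * v)\<^sup>2)"
proof -
  \<comment> \<open>Clearing the denominator leaves an identity between polynomials.\<close>
  have "N * Y = - (W * (a\<^sup>2 + 2 * \<tau>)) * (E\<^sup>2 - N * G / 2)
      + N * W * a * (D * E + G - (m + 2) / 2 * G)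
      - W * (a * b + \<tau> * (m - 2 * a)) * v * E + N * W * b * (G + v * D)
      - (W * (a * q - \<tau> * b - a * \<tau> * (m - 2 * a) / 2) + 2 * (W * q)) * v\<^sup>2
      + W * q * ((m + 2) * v\<^sup>2 + 2 * v * E)"
    unfolding Y using N by (simp add: field_simps)
  then have "N * (N * W * D\<^sup>2) - 2 * \<tau> * a\<^sup>2 * W * v\<^sup>2 - 4 * (N * Y) =
     W * ((N * D - 2 * (a * E + b * v))\<^sup>2 + 8 * \<tau> * (E + (m - a) / 2 * v)\<^sup>2)"
    unfolding b q by (simp only:) (simp add: b field_simps power2_eq_square)
  then show ?thesis using N by (simp add: field_simps)
qed

lemma has_partial_deriv_log_radial:
  assumes "(F has_real_derivative F') (at (L - ln (x \<bullet> x) / 2))" "x \<noteq> 0"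
  shows "has_partial_deriv i (\<lambda>x. F (L - ln (x \<bullet> x) / 2)) x (- F' * x $ i / (x \<bullet> x))"
proof -
  have "((\<lambda>t. L - ln t / 2) has_real_derivative (- (1 / (x \<bullet> x)) / 2)) (at (x \<bullet> x))"
    using assms(2) by (auto intro!: derivative_eq_intros)
  from has_partial_deriv_chain[OF assms(1) has_partial_deriv_chain[OF this has_partial_deriv_inner_self]]
  show ?thesis by (rule has_partial_deriv_cong) (simp add: field_simps)
qed

text \<open>Up to a divergence, which integrates to zero, \<open>F\<close> is a positive factor
  times a sum of squares. Vanishing of \<open>v\<close> near the origin keeps the singular weight
  out of play.\<close>

lemma carleman_estimate:
  fixes v :: "real ^ 'n::finite \<Rightarrow> real" and L \<tau> :: real
  assumes jet: "C2_jet v g h" and \<tau>: "\<tau> > 0" and r0: "r0 > 0"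
    and near: "\<And>x. norm x < r0 \<Longrightarrow> v x = 0" and far: "\<And>x. norm x \<ge> \<rho> \<Longrightarrow> v x = 0"
  defines "l \<equiv> \<lambda>x :: real ^ 'n. L - ln (x \<bullet> x) / 2"
  defines "F \<equiv> \<lambda>x. (x \<bullet> x) * exp (\<tau> * (l x)\<^sup>2) * (\<Sum>i\<in>UNIV. h i i x)\<^sup>2
     - 8 * \<tau> ^ 3 * (l x)\<^sup>2 * exp (\<tau> * (l x)\<^sup>2) * (v x)\<^sup>2 / (x \<bullet> x)"
  shows "integrable lborel F" "0 \<le> (LINT x|lborel. F x)"
proof -
  note jetD = C2_jetD[OF jet]
  define m where "m = real CARD('n) - 2"
  define A where "A t = exp (\<tau> * t\<^sup>2) * (2 * \<tau> * t)" for t :: real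
  \<comment> \<open>Up to the factor \<open>exp (\<tau> * l\<^sup>2 / 2)\<close>,
    \<open>a * E + b * v\<close> is the antisymmetric part of the conjugated operator applied to
    \<open>exp (\<tau> * l\<^sup>2 / 2) * v\<close>. The first square in the identity is therefore
    that of the symmetric minus the antisymmetric part, and \<open>q\<close> is the zero-order flux
    completing the divergence.\<close>
  define b where "b t = (2 * \<tau> * t * m - (2 * \<tau> * t)\<^sup>2) / 2 - \<tau>" for t
  define q where "q t = - (2 * \<tau> * t * b t + \<tau> * m) / 2" for t
  define A' where "A' t = exp (\<tau> * t\<^sup>2) * ((2 * \<tau> * t)\<^sup>2 + 2 * \<tau>)" for t
  define b' where "b' t = \<tau> * (m - 2 * (2 * \<tau> * t))" for t
  define B' where "B' t = exp (\<tau> * t\<^sup>2) * (2 * \<tau> * t * b t + b' t)" for t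
  define Q' where "Q' t = exp (\<tau> * t\<^sup>2) * (2 * \<tau> * t * q t - \<tau> * b t - 2 * \<tau> * t * b' t / 2)" for t
  have A: "(A has_real_derivative A' t) (at t)" for t
    unfolding A_def A'_def
    by (auto intro!: derivative_eq_intros simp: power2_eq_square algebra_simps)
  have b: "(b has_real_derivative b' t) (at t)" for t
    unfolding b_def b'_def
    by (auto intro!: derivative_eq_intros simp: power2_eq_square field_simps)
  have q: "(q has_real_derivative (- \<tau> * b t - 2 * \<tau> * t * b' t / 2)) (at t)" for t
    unfolding q_def
    by (auto intro!: derivative_eq_intros b simp: field_simps)
  have B: "((\<lambda>t. exp (\<tau> * t\<^sup>2) * b t) has_real_derivative B' t) (at t)" for t
    unfolding B'_def by (auto intro!: derivative_eq_intros b simp: algebra_simps)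
  have Q: "((\<lambda>t. exp (\<tau> * t\<^sup>2) * q t) has_real_derivative Q' t) (at t)" for t
    unfolding Q'_def by (auto intro!: derivative_eq_intros q simp: algebra_simps)
  define E where "E x = (\<Sum>j\<in>UNIV. x $ j * g j x)" for x
  define G where "G x = (\<Sum>j\<in>UNIV. g j x * g j x)" for x
  define E' where "E' i x = (\<Sum>j\<in>UNIV. axis i 1 $ j * g j x + x $ j * h j i x)" for i x
  define G' where "G' i x = (\<Sum>j\<in>UNIV. h j i x * g j x + g j x * h j i x)" for i x
  have E: "has_partial_deriv i E x (E' i x)" for i x
    unfolding E_def E'_def
    by (intro has_partial_deriv_sum has_partial_deriv_mult has_partial_deriv_nth jetD)
  have G: "has_partial_deriv i G x (G' i x)" for i x
    unfolding G_def G'_def by (intro has_partial_deriv_sum has_partial_deriv_mult jetD)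
  define N where "N x = x \<bullet> x" for x :: "real ^ 'n"
  define Y where "Y i x = A (l x) * (g i x * E x - 1 / 2 * (x $ i * G x))
     + exp (\<tau> * (l x)\<^sup>2) * b (l x) * (v x * g i x)
     + exp (\<tau> * (l x)\<^sup>2) * q (l x) * inverse (N x) * (x $ i * (v x * v x))" for i x
  \<comment> \<open>Laid out exactly as the product rule delivers it, so that \<open>pd_off\<close>
    follows by resolution.\<close>
  define Y' where "Y' i x =
      (- A' (l x) * x $ i / N x) * (g i x * E x - 1 / 2 * (x $ i * G x))
      + A (l x) * (h i i x * E x + g i x * E' i x - 1 / 2 * (1 * G x + x $ i * G' i x))
      + ((- B' (l x) * x $ i / N x) * (v x * g i x)
      + exp (\<tau> * (l x)\<^sup>2) * b (l x) * (g i x * g i x + v x * h i i x))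
      + (((- Q' (l x) * x $ i / N x) * inverse (N x)
         + exp (\<tau> * (l x)\<^sup>2) * q (l x) * (- inverse ((N x)\<^sup>2) * (2 * x $ i))) * (x $ i * (v x * v x))
      + exp (\<tau> * (l x)\<^sup>2) * q (l x) * inverse (N x) * (1 * (v x * v x) + x $ i * (g i x * v x + v x * g i x)))"
    for i x
  have N_pos: "N x > 0" if "x \<noteq> 0" for x using that by (simp add: N_def)
  have pd_off: "has_partial_deriv i (Y i) x (Y' i x)" if x: "x \<noteq> 0" for i x
  proof -
    have N: "has_partial_deriv i (\<lambda>x. inverse (N x)) x (- inverse ((N x)\<^sup>2) * (2 * x $ i))"
    proof -
      have "(inverse has_real_derivative (- inverse ((x \<bullet> x)\<^sup>2))) (at (x \<bullet> x))"
        using x by (auto intro!: derivative_eq_intros simp: power2_eq_square)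
      from has_partial_deriv_chain[OF this has_partial_deriv_inner_self] show ?thesis
        by (simp add: N_def)
    qed
    have c: "has_partial_deriv i (\<lambda>x. x $ i) x 1"
      using has_partial_deriv_nth[of i i x] by simp
    have A1: "has_partial_deriv i (\<lambda>x. A (l x)) x (- A' (l x) * x $ i / N x)"
      using has_partial_deriv_log_radial[OF A x] by (simp add: l_def N_def)
    have B1: "has_partial_deriv i (\<lambda>x. exp (\<tau> * (l x)\<^sup>2) * b (l x)) x (- B' (l x) * x $ i / N x)"
      using has_partial_deriv_log_radial[OF B x] by (simp add: l_def N_def)
    have Q1: "has_partial_deriv i (\<lambda>x. exp (\<tau> * (l x)\<^sup>2) * q (l x)) x (- Q' (l x) * x $ i / N x)"
      using has_partial_deriv_log_radial[OF Q x] by (simp add: l_def N_def)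
    have half: "has_partial_deriv i (\<lambda>x. 1 / 2 * f x) x (1 / 2 * D)"
      if "has_partial_deriv i f x D" for f D
      using has_partial_deriv_mult[OF has_partial_deriv_const that, of "1/2"] by simp
    show ?thesis
      unfolding Y_def Y'_def
      by (intro has_partial_deriv_add has_partial_deriv_diff has_partial_deriv_mult half
          A1 B1 Q1 N c E G jetD)
  qed
  have zero: "v x = 0" "g i x = 0" "h i j x = 0" if "norm x < r0 \<or> norm x > \<rho>" for x i j
  proof -
    define S where "S = ball 0 r0 \<union> - cball (0 :: real ^ 'n) \<rho>"
    have S: "open S" "x \<in> S" "\<And>y. y \<in> S \<Longrightarrow> v y = 0"
      using that near far by (auto simp: S_def open_Un)
    show "v x = 0" "g i x = 0" "h i j x = 0"
      using C2_jet_eq_0_on_open[OF jet S(1,3,2)] S by auto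
  qed
  have zeroY: "Y i x = 0" "Y' i x = 0" "F x = 0" if "norm x < r0 \<or> norm x > \<rho>" for x i
    using zero[OF that] by (auto simp: Y_def Y'_def F_def E_def G_def G'_def)
  \<comment> \<open>At the origin the logarithm and the inverse are mere default values, but
    \<open>Y\<close> vanishes on a whole ball around it.\<close>
  have pd: "has_partial_deriv i (Y i) x (Y' i x)" for i x
  proof (cases "x = 0")
    case True
    have "has_partial_deriv i (Y i) x 0"
      by (rule has_partial_deriv_local[OF has_partial_deriv_const, of "ball 0 r0"])
        (use True r0 zeroY in auto)
    then show ?thesis using zeroY True r0 by simp
  qed (rule pd_off)
  have cont_UNIV: "continuous_on UNIV f"
    if "continuous_on (- {0}) f" "\<And>x. norm x < r0 \<Longrightarrow> f x = 0" for f :: "real ^ 'n \<Rightarrow> real"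
  proof -
    have "continuous_on (ball 0 r0 \<union> - {0}) f"
    proof (rule continuous_on_open_Un)
      show "continuous_on (ball 0 r0) f"
        using that(2) by (subst continuous_on_cong[OF refl, of _ _ "\<lambda>_. 0"]) auto
    qed (use that in auto)
    moreover have "ball 0 r0 \<union> - {0} = (UNIV :: (real ^ 'n) set)" using r0 by auto
    ultimately show ?thesis by simp
  qed
  have cont0: "continuous_on (- {0}) v" "continuous_on (- {0}) (g i)" "continuous_on (- {0}) (h i j)" for i j
    using jetD(3-5) by (auto intro: continuous_on_subset)
  have l_cont: "continuous_on (- {0}) l"
    unfolding l_def by (auto intro!: continuous_intros)
  have N_cont: "continuous_on (- {0}) N" unfolding N_def by (intro continuous_intros)
  have N_neq: "\<forall>x\<in>- {0}. N x \<noteq> 0" by (simp add: N_def)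
  have Y'_cont: "continuous_on UNIV (Y' i)" for i
    by (rule cont_UNIV)
      (use N_neq zeroY in \<open>auto simp: Y'_def[abs_def] A_def A'_def B'_def Q'_def E_def E'_def G_def G'_def b_def b'_def q_def
        intro!: continuous_intros cont0 l_cont N_cont\<close>)
  have Y_cont: "continuous_on UNIV (Y i)" for i
    by (rule cont_UNIV)
      (use N_neq zeroY in \<open>auto simp: Y_def[abs_def] A_def E_def G_def b_def q_def
        intro!: continuous_intros cont0 l_cont N_cont\<close>)
  have F_cont: "continuous_on UNIV F"
    by (rule cont_UNIV)
      (use N_neq zeroY in \<open>auto simp: F_def intro!: continuous_intros cont0 l_cont\<close>)
  \<comment> \<open>The radius is \<open>\<rho> + 1\<close> because vanishing of the derivatives is
    only available on the open exterior \<open>norm x > \<rho>\<close>.\<close>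
  show intF: "integrable lborel F"
    by (rule integrable_continuous_compact_support[OF F_cont, where \<rho> = "\<rho> + 1"]) (auto simp: zeroY)
  have intY': "integrable lborel (Y' i)" for i
    by (rule integrable_continuous_compact_support[OF Y'_cont, where \<rho> = "\<rho> + 1"]) (auto simp: zeroY)
  have "(LINT x|lborel. Y' i x) = 0" for i
    by (rule integral_partial_deriv_eq_0[OF pd Y_cont Y'_cont, where \<rho> = "\<rho> + 1"]) (auto simp: zeroY)
  then have "(LINT x|lborel. F x) = (LINT x|lborel. F x - 4 * (\<Sum>i\<in>UNIV. Y' i x))"
    using intF intY' by (simp add: Bochner_Integration.integral_sum)
  also have "\<dots> \<ge> 0"
  proof (intro integral_nonneg_AE AE_I2)
    fix x
    show "F x - 4 * (\<Sum>i\<in>UNIV. Y' i x) \<ge> 0"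
    proof (cases "x = 0")
      case True
      then show ?thesis using zeroY[of x] r0 by simp
    next
      case False
      define D where "D = (\<Sum>i\<in>UNIV. h i i x)"
      define t where "t = l x"
      define W where "W = exp (\<tau> * t\<^sup>2)"
      define a where "a = 2 * \<tau> * t"
      have Nsum: "N x = (\<Sum>i\<in>UNIV. x $ i * x $ i)"
        by (simp add: N_def inner_vec_def)
      have E'_eq: "E' i x = g i x + (\<Sum>j\<in>UNIV. x $ j * h j i x)" for i
        by (simp add: E'_def sum.distrib axis_def if_distrib[of "\<lambda>c. c * _"] cong: if_cong)
      have G'_eq: "G' i x = 2 * (\<Sum>j\<in>UNIV. g j x * h j i x)" for i
        by (simp add: G'_def sum_distrib_left mult.commute)
      \<comment> \<open>By symmetry of the Hessian the two mixed contractions cancel in the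
        divergence, so that only the Laplacian survives among the second derivatives.\<close>
      have sym: "(\<Sum>i\<in>UNIV. x $ i * (\<Sum>j\<in>UNIV. g j x * h j i x))
          = (\<Sum>i\<in>UNIV. g i x * (\<Sum>j\<in>UNIV. x $ j * h j i x))"
      proof -
        have "(\<Sum>i\<in>UNIV. x $ i * (\<Sum>j\<in>UNIV. g j x * h j i x))
           = (\<Sum>j\<in>UNIV. \<Sum>i\<in>UNIV. x $ i * (g j x * h j i x))"
          unfolding sum_distrib_left by (rule sum.swap)
        also have "\<dots> = (\<Sum>j\<in>UNIV. \<Sum>i\<in>UNIV. g j x * (x $ i * h i j x))"
          by (intro sum.cong refl) (simp add: jetD(6)[of _ _ x] mult_ac)
        finally show ?thesis by (simp add: sum_distrib_left)
      qed
      have "(\<Sum>i\<in>UNIV. Y' i x) = - A' t / N x * ((E x)\<^sup>2 - N x * G x / 2)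
         + A t * (D * E x + G x - (m + 2) / 2 * G x)
         - B' t / N x * v x * E x + W * b t * (G x + v x * D)
         - (Q' t + 2 * (W * q t)) / N x * (v x)\<^sup>2
         + W * q t / N x * ((m + 2) * (v x)\<^sup>2 + 2 * v x * E x)"
      proof -
        \<comment> \<open>Coefficients free of \<open>i\<close>: summation turns their partners into
          \<open>N\<close>, \<open>E\<close>, \<open>G\<close>, \<open>D\<close>, and
          \<open>c5\<close> picks up the dimension \<open>m + 2\<close>.\<close>
        define c1 where "c1 = A' t / N x * G x / 2 - (Q' t + 2 * (W * q t)) / (N x)\<^sup>2 * (v x)\<^sup>2"
        define c2 where "c2 = - A' t / N x * E x - B' t / N x * v x + 2 * (W * q t) / N x * v x"
        define c3 where "c3 = A t + W * b t"
        define c4 where "c4 = A t * E x + W * b t * v x"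
        define c5 where "c5 = - A t * G x / 2 + W * q t / N x * (v x)\<^sup>2"
        have "Y' i x = c1 * (x $ i * x $ i) + c2 * (x $ i * g i x) + c3 * (g i x * g i x) + c4 * h i i x
            + A t * (g i x * (\<Sum>j\<in>UNIV. x $ j * h j i x))
            - A t * (x $ i * (\<Sum>j\<in>UNIV. g j x * h j i x)) + c5" for i
          unfolding Y'_def E'_eq G'_eq t_def[symmetric] W_def[symmetric] c1_def c2_def c3_def c4_def c5_def
          using N_pos[OF False] by (simp add: field_simps power2_eq_square)
        then have "(\<Sum>i\<in>UNIV. Y' i x) = c1 * N x + c2 * E x + c3 * G x + c4 * D
            + A t * (\<Sum>i\<in>UNIV. g i x * (\<Sum>j\<in>UNIV. x $ j * h j i x))
            - A t * (\<Sum>i\<in>UNIV. x $ i * (\<Sum>j\<in>UNIV. g j x * h j i x)) + (m + 2) * c5"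
          by (simp add: sum.distrib sum_subtractf Nsum E_def G_def D_def m_def flip: sum_distrib_left)
        also have "\<dots> = c1 * N x + c2 * E x + c3 * G x + c4 * D + (m + 2) * c5"
          using sym by simp
        finally show ?thesis
          unfolding c1_def c2_def c3_def c4_def c5_def
          using N_pos[OF False] by (simp add: field_simps power2_eq_square)
      qed
      then have "F x - 4 * (\<Sum>i\<in>UNIV. Y' i x)
        = W / N x * ((N x * D - 2 * (a * E x + b t * v x))\<^sup>2 + 8 * \<tau> * (E x + (m - a) / 2 * v x)\<^sup>2)"
        using carleman_algebraic_identity[OF N_pos[OF False], of "b t" a m \<tau> "q t" _ W "E x" "G x" D "v x"]
        by (simp add: F_def A'_def A_def B'_def Q'_def b_def q_def b'_def N_def D_def W_def a_def t_def
           power2_eq_square power3_eq_cube mult_ac)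
      also have "\<dots> \<ge> 0" using N_pos[OF False] \<tau> by (simp add: W_def)
      finally show ?thesis .
    qed
  qed
  finally show "0 \<le> (LINT x|lborel. F x)" .
qed

section \<open>Unique continuation\<close>

lemma C2_jet_radial:
  fixes \<theta> :: "real \<Rightarrow> real"
  assumes \<theta>: "\<And>t. (\<theta> has_real_derivative \<theta>' t) (at t)" "\<And>t. (\<theta>' has_real_derivative \<theta>'' t) (at t)"
    and cont: "continuous_on UNIV \<theta>''"
  shows "C2_jet (\<lambda>x :: real ^ 'n::finite. \<theta> (x \<bullet> x)) (\<lambda>i x. \<theta>' (x \<bullet> x) * (2 * x $ i))
    (\<lambda>i j x. (\<theta>'' (x \<bullet> x) * (2 * x $ j)) * (2 * x $ i) + \<theta>' (x \<bullet> x) * (2 * axis j 1 $ i))"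
  unfolding C2_jet_def
proof (intro conjI allI)
  have cont': "continuous_on UNIV \<theta>'"
    using \<theta>(2) by (auto intro!: DERIV_isCont simp: continuous_on_eq_continuous_at)
  fix i j and x :: "real ^ 'n"
  show "has_partial_deriv i (\<lambda>x. \<theta> (x \<bullet> x)) x (\<theta>' (x \<bullet> x) * (2 * x $ i))"
    by (rule has_partial_deriv_chain[OF \<theta>(1) has_partial_deriv_inner_self])
  have "has_partial_deriv j (\<lambda>x. 2 * x $ i) x (2 * axis j 1 $ i)"
    by (rule has_partial_deriv_cong[OF has_partial_deriv_mult[OF has_partial_deriv_const has_partial_deriv_nth]])
      simp
  then show "has_partial_deriv j (\<lambda>x. \<theta>' (x \<bullet> x) * (2 * x $ i)) x
      ((\<theta>'' (x \<bullet> x) * (2 * x $ j)) * (2 * x $ i) + \<theta>' (x \<bullet> x) * (2 * axis j 1 $ i))"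
    by (intro has_partial_deriv_mult has_partial_deriv_chain[OF \<theta>(2) has_partial_deriv_inner_self])
  show "continuous_on UNIV (\<lambda>x :: real ^ 'n.
      (\<theta>'' (x \<bullet> x) * (2 * x $ j)) * (2 * x $ i) + \<theta>' (x \<bullet> x) * (2 * axis j 1 $ i))"
    by (intro continuous_intros continuous_on_compose2[OF cont] continuous_on_compose2[OF cont']) auto
qed

text \<open>Two nested cubes of positive parts: cubing makes each corner twice continuously
  differentiable, which is the smoothness a \<open>C2_jet\<close> asks for.\<close>

lemma cutoff_exists:
  obtains \<theta> \<theta>' \<theta>'' :: "real \<Rightarrow> real" where
    "\<And>t. (\<theta> has_real_derivative \<theta>' t) (at t)" "\<And>t. (\<theta>' has_real_derivative \<theta>'' t) (at t)"
    "continuous_on UNIV \<theta>''"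
    "\<And>t. t \<le> \<rho> \<Longrightarrow> \<theta> t = 1" "\<And>t. t \<le> \<rho> \<Longrightarrow> \<theta>' t = 0" "\<And>t. t \<le> \<rho> \<Longrightarrow> \<theta>'' t = 0"
    "\<And>t. t \<ge> \<rho> + 1 \<Longrightarrow> \<theta> t = 0"
proof
  define p where "p t = max 0 (t - \<rho>)" for t
  define P where "P t = max 0 (1 - p t ^ 3)" for t
  define \<theta> where "\<theta> t = P t ^ 3" for t
  define \<theta>' where "\<theta>' t = - 9 * P t ^ 2 * p t ^ 2" for t
  define \<theta>'' where "\<theta>'' t = 54 * P t * p t ^ 4 - 18 * P t ^ 2 * p t" for t
  have p: "((\<lambda>t. p t ^ n) has_real_derivative real n * p t ^ (n - 1)) (at t)" if "n \<ge> 2" for n t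
  proof -
    have "((\<lambda>t. t - \<rho>) has_real_derivative 1) (at t)" by (auto intro!: derivative_eq_intros)
    from DERIV_chain2[OF DERIV_pos_part_power[OF that] this] show ?thesis by (simp add: p_def)
  qed
  have P: "((\<lambda>t. P t ^ n) has_real_derivative real n * P t ^ (n - 1) * (- 3 * p t ^ 2)) (at t)"
    if "n \<ge> 2" for n t
  proof -
    have "((\<lambda>t. 1 - p t ^ 3) has_real_derivative 0 - real 3 * p t ^ (3 - 1)) (at t)"
      by (intro DERIV_diff DERIV_const p) simp
    from DERIV_chain2[OF DERIV_pos_part_power[OF that] this] show ?thesis
      by (simp add: P_def[abs_def])
  qed
  show "(\<theta> has_real_derivative \<theta>' t) (at t)" for t
    using P[of 3 t] by (simp add: \<theta>_def[abs_def] \<theta>'_def mult_ac)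
  show "(\<theta>' has_real_derivative \<theta>'' t) (at t)" for t
  proof -
    have "((\<lambda>t. - 9 * (P t ^ 2 * p t ^ 2)) has_real_derivative
        - 9 * (real 2 * P t ^ (2 - 1) * (- 3 * p t ^ 2) * p t ^ 2 + real 2 * p t ^ (2 - 1) * P t ^ 2)) (at t)"
      by (intro DERIV_cmult DERIV_mult P p order_refl)
    then show ?thesis
      by (simp add: \<theta>'_def[abs_def] \<theta>''_def power2_eq_square power4_eq_xxxx algebra_simps)
  qed
  show "continuous_on UNIV \<theta>''"
    unfolding \<theta>''_def P_def p_def by (intro continuous_intros)
  show "\<theta> t = 1" "\<theta>' t = 0" "\<theta>'' t = 0" if "t \<le> \<rho>" for t
    using that by (auto simp: \<theta>_def \<theta>'_def \<theta>''_def p_def P_def)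
  show "\<theta> t = 0" if "t \<ge> \<rho> + 1" for t
  proof -
    have "1 \<le> p t ^ 3" using that by (intro one_le_power) (simp add: p_def)
    then show ?thesis by (simp add: \<theta>_def P_def)
  qed
qed

text \<open>As \<open>\<tau> \<rightarrow> \<infinity>\<close> the Carleman weight on \<open>x \<bullet> x \<le> s\<close> dominates the one on the region where the cutoff
  is not constant, which lies in \<open>s + 1 \<le> x \<bullet> x \<le> s + 2\<close>.\<close>

lemma unique_continuation_from_ball:
  fixes u :: "real ^ 'n::finite \<Rightarrow> real"
  assumes jet: "C2_jet u g h" and eq: "\<And>x. (\<Sum>i\<in>UNIV. h i i x) = V x * u x"
    and V: "\<And>x. \<bar>V x\<bar> \<le> M" and r0: "r0 > 0" and near: "\<And>x. norm x < r0 \<Longrightarrow> u x = 0"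
  shows "u x = 0"
proof -
  \<comment> \<open>The added 1 makes the weight \<open>s - y \<bullet> y\<close> of the later test
    function positive at \<open>x\<close>.\<close>
  define s where "s = x \<bullet> x + 1"
  have s: "s \<ge> 1" "x \<bullet> x < s" by (auto simp: s_def)
  define \<rho> where "\<rho> = s + 1"
  obtain \<theta> \<theta>' \<theta>'' :: "real \<Rightarrow> real" where
    \<theta>: "\<And>t. (\<theta> has_real_derivative \<theta>' t) (at t)" "\<And>t. (\<theta>' has_real_derivative \<theta>'' t) (at t)"
    "continuous_on UNIV \<theta>''"
    "\<And>t. t \<le> \<rho> \<Longrightarrow> \<theta> t = 1" "\<And>t. t \<le> \<rho> \<Longrightarrow> \<theta>' t = 0" "\<And>t. t \<le> \<rho> \<Longrightarrow> \<theta>'' t = 0"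
    "\<And>t. t \<ge> \<rho> + 1 \<Longrightarrow> \<theta> t = 0"
    using cutoff_exists[of \<rho>] by metis
  note jet_prod = C2_jet_mult[OF C2_jet_radial[OF \<theta>(1-3)] jet]
  define v where "v y = \<theta> (y \<bullet> y) * u y" for y
  obtain g' h' where v: "C2_jet v g' h'"
    and h': "\<And>i y. y \<bullet> y \<le> \<rho> \<Longrightarrow> h' i i y = h i i y"
  proof
    show "C2_jet v
       (\<lambda>i x. \<theta>' (x \<bullet> x) * (2 * x $ i) * u x + \<theta> (x \<bullet> x) * g i x)
       (\<lambda>i j x. (((\<theta>'' (x \<bullet> x) * (2 * x $ j)) * (2 * x $ i) + \<theta>' (x \<bullet> x) * (2 * axis j 1 $ i)) * u x
          + \<theta>' (x \<bullet> x) * (2 * x $ i) * g j x)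
        + (\<theta>' (x \<bullet> x) * (2 * x $ j) * g i x + \<theta> (x \<bullet> x) * h i j x))"
      unfolding v_def by (rule jet_prod)
  qed (simp add: \<theta>)
  define r where "r = sqrt (\<rho> + 1)"
  have r: "norm y < r \<longleftrightarrow> y \<bullet> y < \<rho> + 1" "norm y \<le> r \<longleftrightarrow> y \<bullet> y \<le> \<rho> + 1" for y :: "real ^ 'n"
    by (simp_all add: r_def norm_eq_sqrt_inner)
  have v_near: "v y = 0" if "norm y < r0" for y using near[OF that] by (simp add: v_def)
  have v_far: "v y = 0" if "norm y \<ge> r" for y using r(1)[of y] that by (simp add: v_def \<theta>)
  have v_eq: "v y = u y" "(\<Sum>i\<in>UNIV. h' i i y) = V y * u y" if "y \<bullet> y \<le> \<rho>" for y
    using that h' by (auto simp: v_def \<theta> eq)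
  \<comment> \<open>This controls the error from the cutoff, uniformly in
    \<open>\<tau>\<close>.\<close>
  have "bounded ((\<lambda>y. (y \<bullet> y) * (\<Sum>i\<in>UNIV. h' i i y)\<^sup>2) ` cball 0 r)"
    by (intro compact_imp_bounded compact_continuous_image continuous_intros
        continuous_on_subset[OF C2_jetD(5)[OF v]]) auto
  then obtain C where C: "\<And>y. norm y \<le> r \<Longrightarrow> (y \<bullet> y) * (\<Sum>i\<in>UNIV. h' i i y)\<^sup>2 \<le> C"
    by (force simp: bounded_iff)
  have C0: "C \<ge> 0" using C[of 0] by (simp add: r_def \<rho>_def s_def)
  \<comment> \<open>Here \<open>L\<close> is the logarithm of \<open>sqrt (\<rho> + 2)\<close>,
    slightly beyond the support radius \<open>sqrt (\<rho> + 1)\<close>, so \<open>l\<close> is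
    positive there and the weight decreases in \<open>|y|\<close>.\<close>
  define l where "l y = ln (\<rho> + 2) / 2 - ln (y \<bullet> y) / 2" for y :: "real ^ 'n"
  define ls where "ls t = (ln (\<rho> + 2) - ln t) / 2" for t
  have ls_mono: "0 < ls t'" "ls t \<ge> ls t'" if "0 < t" "t \<le> t'" "t' \<le> \<rho> + 1" for t t'
  proof -
    have "ln t \<le> ln t'" "ln t' < ln (\<rho> + 2)" using that by simp_all
    then show "0 < ls t'" "ls t \<ge> ls t'" by (simp_all add: ls_def)
  qed
  have ls_strict: "ls \<rho> < ls s" using s by (simp add: ls_def \<rho>_def)
  have l_ls: "l y = ls (y \<bullet> y)" for y by (simp add: l_def ls_def field_simps)
  \<comment> \<open>The gap between the exponents at \<open>s\<close> and at the edge of the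
    transition layer, hence the decay rate in \<open>\<tau>\<close>.\<close>
  define \<delta> where "\<delta> = (ls s)\<^sup>2 - (ls \<rho>)\<^sup>2"
  have \<delta>: "\<delta> > 0"
    using ls_strict ls_mono[of \<rho> \<rho>] s by (simp add: \<delta>_def \<rho>_def power_strict_mono)
  \<comment> \<open>A continuous substitute for the indicator of
    \<open>y \<bullet> y \<le> s\<close>, so that a zero integral forces pointwise
    vanishing.\<close>
  define f where "f y = max 0 (s - y \<bullet> y) * (u y)\<^sup>2" for y
  have f_cont: "continuous_on UNIV f"
    unfolding f_def by (intro continuous_intros C2_jetD(3)[OF jet])
  have f_supp: "f y = 0" if "norm y \<ge> r" for y
    using that r(1)[of y] by (simp add: f_def \<rho>_def)
  have f_int: "integrable lborel f"
    by (rule integrable_continuous_compact_support[OF f_cont f_supp])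
  have f_nonneg: "f y \<ge> 0" for y by (simp add: f_def)
  define c where "c = C * measure lborel (cball (0 :: real ^ 'n) r)"
  \<comment> \<open>The threshold on \<open>\<tau>\<close> makes the gain
    \<open>8 * \<tau> ^ 3 * (l y)\<^sup>2 / (y \<bullet> y)\<close> exceed the potential term by at
    least 1 wherever \<open>0 < y \<bullet> y \<le> \<rho>\<close>.\<close>
  have bound: "(LINT y|lborel. f y) / s \<le> c * exp (- (\<tau> * \<delta>))"
    if \<tau>: "\<tau> > 0" "8 * \<tau> ^ 3 * (ls \<rho>)\<^sup>2 \<ge> \<rho> * (\<rho> * M\<^sup>2 + 1)" for \<tau>
  proof -
    define F where "F y = (y \<bullet> y) * exp (\<tau> * (l y)\<^sup>2) * (\<Sum>i\<in>UNIV. h' i i y)\<^sup>2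
     - 8 * \<tau> ^ 3 * (l y)\<^sup>2 * exp (\<tau> * (l y)\<^sup>2) * (v y)\<^sup>2 / (y \<bullet> y)" for y
    have F: "integrable lborel F" "0 \<le> (LINT y|lborel. F y)"
      unfolding F_def[abs_def] l_def[abs_def]
      by (rule carleman_estimate[OF v \<tau>(1) r0 v_near v_far]; assumption)+
    have le: "F y \<le> indicator (cball 0 r) y *\<^sub>R (C * exp (\<tau> * (ls \<rho>)\<^sup>2)) - exp (\<tau> * (ls s)\<^sup>2) * (f y / s)" for y
    proof -
      \<comment> \<open>Outside the support, the transition layer, the origin (apart because of the
        division), and the region where \<open>v\<close> solves the equation.\<close>
      consider "y \<bullet> y > \<rho> + 1" | "\<rho> < y \<bullet> y" "y \<bullet> y \<le> \<rho> + 1" | "y = 0" | "y \<bullet> y \<le> \<rho>" "y \<noteq> 0" by fastforce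
      then show ?thesis
      proof cases
        case 1
        then have "y \<in> - cball 0 r" using r[of y] by simp
        from C2_jet_eq_0_on_open[OF v _ _ this] have "h' i i y = 0" for i
          using v_far by auto
        moreover have "v y = 0" using v_far r[of y] 1 by simp
        ultimately show ?thesis using 1 r[of y] by (simp add: F_def f_def \<rho>_def)
      next
        case 2
        have y: "norm y \<le> r" using 2 r by simp
        have "F y \<le> exp (\<tau> * (l y)\<^sup>2) * ((y \<bullet> y) * (\<Sum>i\<in>UNIV. h' i i y)\<^sup>2)"
          using \<tau>(1) by (simp add: F_def mult_ac)
        also have "\<dots> \<le> exp (\<tau> * (ls \<rho>)\<^sup>2) * C"
        proof (rule mult_mono)
          have "(l y)\<^sup>2 \<le> (ls \<rho>)\<^sup>2" unfolding l_ls
            using ls_mono[of "y \<bullet> y" "y \<bullet> y"] ls_mono[of \<rho> "y \<bullet> y"] 2 s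
            by (intro power_mono) (auto simp: \<rho>_def)
          then show "exp (\<tau> * (l y)\<^sup>2) \<le> exp (\<tau> * (ls \<rho>)\<^sup>2)" using \<tau>(1) by simp
        qed (use C[OF y] in auto)
        finally show ?thesis using 2 y by (simp add: f_def \<rho>_def mult.commute)
      next
        case 3
        then show ?thesis using near[of 0] r0 C0 by (simp add: F_def f_def indicator_def)
      next
        case 4
        have N: "0 < y \<bullet> y" using 4 by simp
        define W where "W = exp (\<tau> * (l y)\<^sup>2)"
        have lsl: "(ls \<rho>)\<^sup>2 \<le> (l y)\<^sup>2" unfolding l_ls
          using ls_mono[OF N, of \<rho>] 4 by (intro power_mono) auto
        have "F y = W * (u y)\<^sup>2 * ((y \<bullet> y) * (V y)\<^sup>2 - 8 * \<tau> ^ 3 * (l y)\<^sup>2 / (y \<bullet> y))"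
          using N v_eq[OF 4(1)] by (simp add: F_def W_def algebra_simps power_mult_distrib)
        also have "\<dots> \<le> W * (u y)\<^sup>2 * (- 1)"
        proof (rule mult_left_mono)
          have "(V y)\<^sup>2 \<le> M\<^sup>2" using V[of y] by (metis abs_ge_zero power2_abs power_mono)
          then have 1: "(y \<bullet> y) * (V y)\<^sup>2 \<le> \<rho> * M\<^sup>2"
            using 4 s by (intro mult_mono) (auto simp: \<rho>_def)
          have "\<rho> * M\<^sup>2 + 1 \<le> 8 * \<tau> ^ 3 * (ls \<rho>)\<^sup>2 / \<rho>"
            using \<tau>(2) s by (simp add: field_simps \<rho>_def)
          also have "\<dots> \<le> 8 * \<tau> ^ 3 * (l y)\<^sup>2 / (y \<bullet> y)"
            using lsl N 4 \<tau>(1) by (intro frac_le mult_left_mono) auto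
          finally show "(y \<bullet> y) * (V y)\<^sup>2 - 8 * \<tau> ^ 3 * (l y)\<^sup>2 / (y \<bullet> y) \<le> - 1" using 1 by simp
        qed (simp add: W_def)
        also have "\<dots> \<le> - (exp (\<tau> * (ls s)\<^sup>2) * (f y / s))"
        proof (cases "y \<bullet> y \<le> s")
          case True
          have "(ls s)\<^sup>2 \<le> (l y)\<^sup>2" unfolding l_ls
            using ls_mono[OF N, of s] True ls_mono[of s s] s by (intro power_mono) (auto simp: \<rho>_def)
          then have 1: "exp (\<tau> * (ls s)\<^sup>2) \<le> W" using \<tau>(1) by (simp add: W_def)
          have "f y \<le> s * (u y)\<^sup>2" unfolding f_def using N s by (intro mult_right_mono) auto
          then have "f y / s \<le> (u y)\<^sup>2" using s by (simp add: field_simps)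
          with 1 have "exp (\<tau> * (ls s)\<^sup>2) * (f y / s) \<le> W * (u y)\<^sup>2"
            using f_nonneg[of y] s by (intro mult_mono) (auto simp: W_def)
          then show ?thesis by simp
        next
          case False
          then show ?thesis by (simp add: f_def W_def)
        qed
        finally have "F y \<le> - (exp (\<tau> * (ls s)\<^sup>2) * (f y / s))" .
        moreover have "0 \<le> indicator (cball 0 r) y *\<^sub>R (C * exp (\<tau> * (ls \<rho>)\<^sup>2))"
          using C0 by simp
        ultimately show ?thesis by linarith
      qed
    qed
    have ind: "integrable lborel (\<lambda>y. indicator (cball (0 :: real ^ 'n) r) y *\<^sub>R (C * exp (\<tau> * (ls \<rho>)\<^sup>2)))"
      by (rule borel_integrable_compact) auto
    have "0 \<le> (LINT y|lborel. indicator (cball 0 r) y *\<^sub>R (C * exp (\<tau> * (ls \<rho>)\<^sup>2)) - exp (\<tau> * (ls s)\<^sup>2) * (f y / s))"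
      using ind f_int by (intro order_trans[OF F(2) integral_mono[OF F(1) _ le]]) auto
    also have "\<dots> = c * exp (\<tau> * (ls \<rho>)\<^sup>2) - exp (\<tau> * (ls s)\<^sup>2) * ((LINT y|lborel. f y) / s)"
      using ind f_int by (simp add: c_def)
    finally have "(LINT y|lborel. f y) / s \<le> c * exp (\<tau> * (ls \<rho>)\<^sup>2) / exp (\<tau> * (ls s)\<^sup>2)"
      by (simp add: field_simps)
    also have "\<dots> = c * exp (- (\<tau> * \<delta>))"
      by (simp add: \<delta>_def algebra_simps exp_diff flip: times_divide_eq_right)
    finally show ?thesis .
  qed
  have "(LINT y|lborel. f y) / s \<le> 0"
  proof (rule tendsto_lowerbound)
    show "((\<lambda>\<tau>. c * exp (- (\<tau> * \<delta>))) \<longlongrightarrow> 0) at_top"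
    proof -
      have "filterlim (\<lambda>\<tau>. \<tau> * \<delta>) at_top at_top"
        using \<delta> by (intro filterlim_at_top_mult_tendsto_pos[where c = \<delta>] filterlim_ident) auto
      then have "((\<lambda>\<tau>. exp (- (\<tau> * \<delta>))) \<longlongrightarrow> 0) at_top"
        by (intro filterlim_compose[OF exp_at_bot] filterlim_compose[OF filterlim_uminus_at_bot_at_top])
      then show ?thesis by (rule tendsto_mult_right_zero)
    qed
    have "(ls \<rho>)\<^sup>2 > 0" using ls_mono[of \<rho> \<rho>] s by (simp add: \<rho>_def)
    then have "filterlim (\<lambda>\<tau>::real. 8 * \<tau> ^ 3 * (ls \<rho>)\<^sup>2) at_top at_top"
      by (intro filterlim_at_top_mult_tendsto_pos[where c = "(ls \<rho>)\<^sup>2"] tendsto_const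
        filterlim_tendsto_pos_mult_at_top[where c = 8] filterlim_pow_at_top filterlim_ident) auto
    then have "eventually (\<lambda>\<tau>. 8 * \<tau> ^ 3 * (ls \<rho>)\<^sup>2 \<ge> \<rho> * (\<rho> * M\<^sup>2 + 1)) at_top"
      by (simp add: filterlim_at_top)
    then show "eventually (\<lambda>\<tau>. (LINT y|lborel. f y) / s \<le> c * exp (- (\<tau> * \<delta>))) at_top"
      using eventually_gt_at_top[of 0] by eventually_elim (rule bound)
  qed simp
  moreover have "(LINT y|lborel. f y) \<ge> 0"
    by (intro integral_nonneg_AE AE_I2 f_nonneg)
  ultimately have "(LINT y|lborel. f y) = 0"
    using s by (simp add: field_simps)
  from integral_zero_imp_zero[OF f_cont f_supp f_nonneg this, where x = x] show "u x = 0"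
    using s by (simp add: f_def)
qed

section \<open>Lower bound on shells\<close>

lemma has_partial_deriv_bounded_linear:
  assumes "bounded_linear \<phi>" "has_partial i f x"
  shows "has_partial_deriv i (\<lambda>x. \<phi> (f x)) x (\<phi> (partial_deriv i f x))"
  using bounded_linear.has_vector_derivative[OF assms(1)] assms(2)
  by (simp add: has_partial_deriv_def has_partial_def partial_deriv_def vector_derivative_works
      has_real_derivative_iff_has_vector_derivative)

text \<open>Taken with \<open>Re\<close> and \<open>Im\<close> for \<open>\<phi>\<close>, this
  passes from complex solutions to real jets.\<close>

lemma C2_on_space_imp_C2_jet:
  fixes u :: "real ^ 'n::finite \<Rightarrow> 'b::real_normed_vector"
  assumes "bounded_linear \<phi>" "C2_on_space u"
  shows "C2_jet (\<lambda>x. \<phi> (u x)) (\<lambda>i x. \<phi> (partial_deriv i u x))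
     (\<lambda>i j x. \<phi> (partial_deriv j (partial_deriv i u) x))"
  using assms(2) unfolding C2_jet_def C2_on_space_def C1_on_space_def
  by (auto intro!: has_partial_deriv_bounded_linear[OF assms(1)]
      bounded_linear.continuous_on[OF assms(1)])

lemma sum_laplacian:
  assumes "bounded_linear \<phi>"
  shows "(\<Sum>i\<in>UNIV. \<phi> (partial_deriv i (partial_deriv i u) x)) = \<phi> (laplacian u x)"
  by (simp add: laplacian_def linear_sum[OF bounded_linear.linear[OF assms]])

theorem corollary2p2:
  fixes V :: "real ^ 'n::finite \<Rightarrow> real" and u :: "real ^ 'n \<Rightarrow> complex"
  assumes "continuous_on UNIV V"
    and "bounded (range V)"
    and "\<And>x. V x \<ge> 0"
    and "C2_on_space u"
    and "\<And>x. laplacian u x = of_real (V x) * u x"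
    and "\<exists>x. u x \<noteq> 0"
  shows "\<exists>c::real. c > 0 \<and>
           (\<forall>R::nat. (LINT x:{x. real R \<le> norm x \<and> norm x \<le> real R + 1}|lborel. (cmod (u x))\<^sup>2) \<ge> c)"
proof -
  obtain M where M: "\<And>x. \<bar>V x\<bar> \<le> M"
    using assms(2) by (auto simp: bounded_iff)
  note re = C2_on_space_imp_C2_jet[OF bounded_linear_Re assms(4)]
  note im = C2_on_space_imp_C2_jet[OF bounded_linear_Im assms(4)]
  have lap: "(\<Sum>i\<in>UNIV. Re (partial_deriv i (partial_deriv i u) x)) = V x * Re (u x)"
    "(\<Sum>i\<in>UNIV. Im (partial_deriv i (partial_deriv i u) x)) = V x * Im (u x)" for x
    by (simp_all only: sum_laplacian[OF bounded_linear_Re] sum_laplacian[OF bounded_linear_Im])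
      (simp_all add: assms(5))
  have "\<exists>y. norm y < 1 / 2 \<and> u y \<noteq> 0"
  proof (rule ccontr)
    assume "\<not> ?thesis"
    then have near: "u x = 0" if "norm x < 1 / 2" for x using that by blast
    have "Re (u x) = 0" "Im (u x) = 0" for x
      using unique_continuation_from_ball[OF re lap(1) M, of "1 / 2"]
        unique_continuation_from_ball[OF im lap(2) M, of "1 / 2"] near by simp_all
    then show False using assms(6) by (simp add: complex_eq_iff)
  qed
  then obtain y where y: "norm y < 1 / 2" "u y \<noteq> 0" by blast
  \<comment> \<open>Written as a sum of products, so that its jet comes from the product
    rule.\<close>
  define w where "w x = Re (u x) * Re (u x) + Im (u x) * Im (u x)" for x
  have w_norm: "w x = (cmod (u x))\<^sup>2" for x
    by (simp add: w_def cmod_power2 flip: power2_eq_square)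
  obtain g h where w: "C2_jet w g h" and sub: "\<And>x. (\<Sum>i\<in>UNIV. h i i x) \<ge> 0"
  proof
    let ?D = "\<lambda>i. partial_deriv i u" and ?D2 = "\<lambda>i j. partial_deriv j (partial_deriv i u)"
    let ?h = "\<lambda>i j x.
      ((Re (?D2 i j x) * Re (u x) + Re (?D i x) * Re (?D j x)) + (Re (?D j x) * Re (?D i x) + Re (u x) * Re (?D2 i j x)))
      + ((Im (?D2 i j x) * Im (u x) + Im (?D i x) * Im (?D j x)) + (Im (?D j x) * Im (?D i x) + Im (u x) * Im (?D2 i j x)))"
    show "C2_jet w (\<lambda>i x. (Re (?D i x) * Re (u x) + Re (u x) * Re (?D i x))
        + (Im (?D i x) * Im (u x) + Im (u x) * Im (?D i x))) ?h"
      unfolding w_def by (rule C2_jet_add[OF C2_jet_mult[OF re re] C2_jet_mult[OF im im]])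
    \<comment> \<open>The Laplacian of \<open>|u|\<^sup>2\<close> is
      \<open>2 * |\<nabla>u|\<^sup>2 + 2 * V * |u|\<^sup>2\<close>, and this is where
      \<open>V \<ge> 0\<close> enters.\<close>
    show "(\<Sum>i\<in>UNIV. ?h i i x) \<ge> 0" for x
    proof -
      have "(\<Sum>i\<in>UNIV. ?h i i x)
        = 2 * (\<Sum>i\<in>UNIV. (Re (?D i x))\<^sup>2 + (Im (?D i x))\<^sup>2)
          + 2 * (Re (u x) * (\<Sum>i\<in>UNIV. Re (?D2 i i x)) + Im (u x) * (\<Sum>i\<in>UNIV. Im (?D2 i i x)))"
        by (simp add: sum.distrib sum_distrib_left power2_eq_square algebra_simps)
      also have "\<dots> = 2 * (\<Sum>i\<in>UNIV. (Re (?D i x))\<^sup>2 + (Im (?D i x))\<^sup>2) + 2 * V x * (cmod (u x))\<^sup>2"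
        unfolding lap cmod_power2 by (simp add: power2_eq_square algebra_simps)
      also have "\<dots> \<ge> 0"
        using assms(3) by (intro add_nonneg_nonneg mult_nonneg_nonneg sum_nonneg) auto
      finally show ?thesis .
    qed
  qed
  define c where "c = w y * (LINT z|lborel. bump (z :: real ^ 'n))"
  show ?thesis
  proof (intro exI[of _ c] conjI allI)
    show "c > 0" using y(2) integral_bump_pos[where 'a = "real ^ 'n"] by (simp add: c_def w_norm)
    fix R :: nat
    define S where "S = {x :: real ^ 'n. real R \<le> norm x \<and> norm x \<le> real R + 1}"
    have S: "compact S"
    proof -
      have "S = cball 0 (real R + 1) - ball 0 (real R)" by (auto simp: S_def)
      then show ?thesis by (simp add: compact_diff)
    qed
    \<comment> \<open>On the middle sphere a ball of radius 1/2 just fits into the shell, and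
      \<open>y\<close> lies inside this sphere for every \<open>R\<close>.\<close>
    obtain x where x: "norm x = real R + 1 / 2" "\<And>z. norm z \<le> real R + 1 / 2 \<Longrightarrow> w z \<le> w x"
      using weak_maximum_principle[OF w sub, of "real R + 1 / 2"] by auto
    have "cball x (1 / 2) \<subseteq> S"
    proof
      fix z assume "z \<in> cball x (1 / 2)"
      then show "z \<in> S"
        using x(1) norm_triangle_ineq2[of x z] norm_triangle_ineq2[of z x]
        by (simp add: S_def dist_norm norm_minus_commute)
    qed
    then have "w x * (LINT z|lborel. bump (z :: real ^ 'n)) \<le> (LINT z:S|lborel. w z)"
      by (intro subharmonic_le_integral[OF w sub _ S]) (simp_all add: w_norm)
    moreover have "c \<le> w x * (LINT z|lborel. bump (z :: real ^ 'n))"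
      unfolding c_def using x(2)[of y] y(1) integral_bump_pos[where 'a = "real ^ 'n"]
      by (intro mult_right_mono) simp_all
    ultimately show "(LINT x:{x. real R \<le> norm x \<and> norm x \<le> real R + 1}|lborel. (cmod (u x))\<^sup>2) \<ge> c"
      by (simp add: S_def w_norm)
  qed
qed

end
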